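(* Let $(E,\tau)$ be a locally convex space. Call an equicontinuous set $M\subseteq E^*$ co-tame if every bounded subset of $(E,\tau)$ is tame over the weak-star closure $\overline M^{w^*}$. The co-tame sets form a convex bornology on $E^*$, and the polar topology $\tau_{tame}$ on $E$ with neighborhood base of zero $\{M^\circ: M \text{ co-tame}\}$ is the strongest locally convex topology on $E$ which is coarser than $\tau$ and for which $E$ is tame. Moreover $\tau_w\subseteq\tau_{tame}\subseteq\tau\subseteq\tau_\mu$, where $\tau_w$ is the weak topology and $\tau_\mu$ the Mackey topology.
   Context: $M^\circ=\{x\in E: |\varphi(x)|\le1\ \forall\varphi\in M\}$. A sequence of real functions $(f_n)$ on a set is independent if there are $a<b$ with $\bigcap_{n\in P} f_n^{-1}(-\infty,a)\cap\bigcap_{n\in M'} f_n^{-1}(b,\infty)\neq\emptyset$ for all finite disjoint $P,M'\subseteq\mathbb N$; a bounded family is tame if it contains no independent sequence. A bounded $B\subseteq E$ is tame over $K\subseteq E^*$ if $\{\varphi\mapsto\varphi(b)\}_{b\in B}$ is a tame family on $K$. A locally convex space $(E,\sigma)$ is tame if every bounded subset is tame over every $\sigma$-equicontinuous weak-star compact subset of $E^*$. The Mackey topology is the strongest locally convex topology on $E$ with dual $E^*$. *)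

theory Defs
  imports "HOL-Analysis.Analysis"
begin

text \<open>Real locally convex spaces: a vector space (type 'a) with a topology T on it.
  Functionals live in the type 'a \<Rightarrow> real, which carries the product (pointwise
  convergence) topology; restricted to the dual this is the weak-star topology.\<close>

definition nhd0 :: "'a::real_vector topology \<Rightarrow> 'a set \<Rightarrow> bool" where
  "nhd0 T U \<longleftrightarrow> (\<exists>V. openin T V \<and> 0 \<in> V \<and> V \<subseteq> U)"

definition lctvs :: "'a::real_vector topology \<Rightarrow> bool" where
  "lctvs T \<longleftrightarrow> topspace T = UNIV
     \<and> continuous_map (prod_topology T T) T (\<lambda>(x, y). x + y)
     \<and> continuous_map (prod_topology euclideanreal T) T (\<lambda>(c, x). c *\<^sub>R x)
     \<and> (\<forall>U. nhd0 T U \<longrightarrow> (\<exists>V. openin T V \<and> 0 \<in> V \<and> convex V \<and> V \<subseteq> U))"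

definition dual :: "'a::real_vector topology \<Rightarrow> ('a \<Rightarrow> real) set" where
  "dual T = {\<phi>. linear \<phi> \<and> continuous_map T euclideanreal \<phi>}"

definition tvs_bounded :: "'a::real_vector topology \<Rightarrow> 'a set \<Rightarrow> bool" where
  "tvs_bounded T B \<longleftrightarrow>
     (\<forall>U. nhd0 T U \<longrightarrow> (\<exists>s>0. \<forall>t. t > s \<longrightarrow> B \<subseteq> (\<lambda>x. t *\<^sub>R x) ` U))"

definition equicontinuous :: "'a::real_vector topology \<Rightarrow> ('a \<Rightarrow> real) set \<Rightarrow> bool" where
  "equicontinuous T M \<longleftrightarrow>
     (\<forall>e>0. \<exists>U. nhd0 T U \<and> (\<forall>\<phi>\<in>M. \<forall>x\<in>U. \<bar>\<phi> x\<bar> < e))"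

definition polar :: "('a \<Rightarrow> real) set \<Rightarrow> 'a set" where
  "polar M = {x. \<forall>\<phi>\<in>M. \<bar>\<phi> x\<bar> \<le> 1}"

definition wstar_closure :: "'a::real_vector topology \<Rightarrow> ('a \<Rightarrow> real) set \<Rightarrow> ('a \<Rightarrow> real) set" where
  "wstar_closure T M = dual T \<inter> closure M"

definition independent_seq :: "(nat \<Rightarrow> 'k \<Rightarrow> real) \<Rightarrow> 'k set \<Rightarrow> bool" where
  "independent_seq f K \<longleftrightarrow> (\<exists>a b. a < b \<and>
     (\<forall>P N. finite P \<and> finite N \<and> P \<inter> N = {} \<longrightarrow>
        (\<exists>k\<in>K. (\<forall>n\<in>P. f n k < a) \<and> (\<forall>n\<in>N. f n k > b))))"

definition tame_family :: "('k \<Rightarrow> real) set \<Rightarrow> 'k set \<Rightarrow> bool" where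
  "tame_family F K \<longleftrightarrow> (\<exists>C. \<forall>f\<in>F. \<forall>k\<in>K. \<bar>f k\<bar> \<le> C)
     \<and> \<not> (\<exists>s. range s \<subseteq> F \<and> independent_seq s K)"

definition tame_over :: "'a set \<Rightarrow> ('a \<Rightarrow> real) set \<Rightarrow> bool" where
  "tame_over B K \<longleftrightarrow> tame_family ((\<lambda>b \<phi>. \<phi> b) ` B) K"

definition tame_lcs :: "'a::real_vector topology \<Rightarrow> bool" where
  "tame_lcs S \<longleftrightarrow> (\<forall>B K. tvs_bounded S B \<and> K \<subseteq> dual S \<and> equicontinuous S K \<and> compact K
       \<longrightarrow> tame_over B K)"

definition cotame :: "'a::real_vector topology \<Rightarrow> ('a \<Rightarrow> real) set set" where
  "cotame T = {M. M \<subseteq> dual T \<and> equicontinuous T M \<and>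
     (\<forall>B. tvs_bounded T B \<longrightarrow> tame_over B (wstar_closure T M))}"

text \<open>Absolutely convex hull of a set of real functionals (functions 'a \<Rightarrow> real carry
  no real_vector instance, so the linear structure is written out pointwise).\<close>
definition abs_conv_hull_fun :: "('a \<Rightarrow> real) set \<Rightarrow> ('a \<Rightarrow> real) set" where
  "abs_conv_hull_fun A = {\<phi>. \<exists>(n::nat) f c. (\<forall>i<n. f i \<in> A) \<and> (\<Sum>i<n. \<bar>c i\<bar>) \<le> (1::real)
       \<and> \<phi> = (\<lambda>x. \<Sum>i<n. c i * f i x)}"

definition convex_bornology :: "('a \<Rightarrow> real) set \<Rightarrow> ('a \<Rightarrow> real) set set \<Rightarrow> bool" where
  "convex_bornology X BB \<longleftrightarrow>
     (\<forall>A\<in>BB. A \<subseteq> X) \<and> (\<forall>x\<in>X. {x} \<in> BB)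
     \<and> (\<forall>A\<in>BB. \<forall>A'. A' \<subseteq> A \<longrightarrow> A' \<in> BB)
     \<and> (\<forall>A\<in>BB. \<forall>A'\<in>BB. A \<union> A' \<in> BB)
     \<and> (\<forall>A\<in>BB. \<forall>c::real. (\<lambda>\<phi> x. c * \<phi> x) ` A \<in> BB)
     \<and> (\<forall>A\<in>BB. abs_conv_hull_fun A \<in> BB)"

definition polar_topology :: "('a::real_vector \<Rightarrow> real) set set \<Rightarrow> 'a topology" where
  "polar_topology BB = topology (\<lambda>U. \<forall>x\<in>U. \<exists>M\<in>BB. (\<lambda>y. x + y) ` polar M \<subseteq> U)"

definition tame_topology :: "'a::real_vector topology \<Rightarrow> 'a topology" where
  "tame_topology T = polar_topology (cotame T)"

definition coarser :: "'a topology \<Rightarrow> 'a topology \<Rightarrow> bool" where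
  "coarser S T \<longleftrightarrow> (\<forall>U. openin S U \<longrightarrow> openin T U)"

definition weak_topology :: "'a::real_vector topology \<Rightarrow> 'a topology" where
  "weak_topology T = topology_generated_by {\<phi> -` V | \<phi> V. \<phi> \<in> dual T \<and> open V}"

definition mackey_topology :: "'a::real_vector topology \<Rightarrow> 'a topology \<Rightarrow> bool" where
  "mackey_topology T \<mu> \<longleftrightarrow> lctvs \<mu> \<and> dual \<mu> = dual T \<and>
     (\<forall>S. lctvs S \<and> dual S = dual T \<longrightarrow> coarser S \<mu>)"

end

theory Submission
  imports Defs
begin

text \<open>The crucial point is that tameness over \<open>M\<close> passes to the bipolar of \<open>M\<close>, which
  contains both the weak-star closure and the absolutely convex hull; moreover every
  \<open>\<tau>\<^sub>t\<^sub>a\<^sub>m\<^sub>e\<close>-equicontinuous set lies in the bipolar of a co-tame set. An independent sequence over the bipolar has, by definition of the polar, a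
  uniform gap over \<open>M \<union> -M\<close> for all convex combinations of differences of its members.
  Ptak's combinatorial lemma turns these averaged gaps into single functionals that alternate along
  long finite sets of indices, and an open Ramsey theorem upgrades alternation to independence
  of a subsequence over \<open>M \<union> -M\<close>, hence over \<open>M\<close>. This replaces Rosenthal's
  dichotomy together with integral representation and dominated convergence.

  Since all functionals stay continuous for \<open>\<tau>\<^sub>t\<^sub>a\<^sub>m\<^sub>e\<close>, Mackey's theorem (by a gliding hump) shows that
  \<open>\<tau>\<^sub>t\<^sub>a\<^sub>m\<^sub>e\<close> has the same bounded sets as \<open>\<tau>\<close>, so \<open>E\<close> is tame for it. Conversely, the polar of a
  neighbourhood in a coarser tame topology is weak-star compact, hence co-tame, and the Hahn-Banach theorem
  recovers the neighbourhood from it.\<close>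

section \<open>An open Ramsey theorem\<close>

text \<open>A functional in the bipolar may realise a pattern only through averaging, so it need not
  resemble any single member of \<open>M\<close>. What passes back to \<open>M\<close> is a lower
  bound at one vector, a convex combination of differences; hence indices are consumed in pairs
  \<open>2 * j\<close>, \<open>2 * j + 1\<close>. The interval crossed by a large difference depends
  on the functional and on \<open>j\<close>; restricting it to a finite grid lets Ptak's lemma
  select one functional and one interval for arbitrarily many pairs.

  Such jumps prescribe low and high values only on given pairs, far from arbitrary patterns. The
  Ramsey theorem is therefore applied to alternation: once every finite subset of \<open>H\<close>
  alternates, the choice of the subset encodes the pattern. The gap is assumed for every increasing
  \<open>r\<close> so that it is still available along \<open>H\<close>.

  Mackey's theorem enters because a coarser topology may have more bounded sets, whereas co-tameness
  tests only the bounded sets of \<tau>.\<close>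

definition init_hit :: "(nat set \<Rightarrow> bool) \<Rightarrow> nat set \<Rightarrow> bool" where
  "init_hit T L \<longleftrightarrow> (\<exists>n. T (L \<inter> {..<n}))"

text \<open>With \<open>T\<close> read as a family of finite sets, \<open>init_hit T\<close> is an
  open condition in the product topology on sets of naturals. Acceptance and rejection are the
  notions of Galvin-Prikry style combinatorial forcing.\<close>

definition accepts :: "(nat set \<Rightarrow> bool) \<Rightarrow> nat set \<Rightarrow> nat set \<Rightarrow> bool" where
  "accepts T s M \<longleftrightarrow>
     (\<forall>L. L \<subseteq> M \<and> infinite L \<and> (\<forall>x\<in>s. \<forall>y\<in>L. x < y) \<longrightarrow> init_hit T (s \<union> L))"

text \<open>Quantifying over all infinite subsets makes rejection hereditary, and its failure
  provides an accepting infinite subset; shrinking therefore decides every \<open>s\<close>.\<close>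

definition rejects :: "(nat set \<Rightarrow> bool) \<Rightarrow> nat set \<Rightarrow> nat set \<Rightarrow> bool" where
  "rejects T s M \<longleftrightarrow> (\<forall>N. N \<subseteq> M \<and> infinite N \<longrightarrow> \<not> accepts T s N)"

lemma rejects_mono: "rejects T s M \<Longrightarrow> N \<subseteq> M \<Longrightarrow> rejects T s N"
  unfolding rejects_def by blast

text \<open>Were there no such \<open>n\<close>, one could build a diagonal sequence whose elements \<open>n\<close>,
  together with some \<open>s \<subseteq> F\<close>, are accepted by its later terms; on an infinite subset the same \<open>s\<close> occurs,
  and that subset accepts \<open>s\<close>.\<close>

lemma rejects_extend:
  assumes F: "finite F" and M: "infinite M" and rej: "\<And>s. s \<subseteq> F \<Longrightarrow> rejects T s M"
  shows "\<exists>n\<in>M. \<exists>M'\<subseteq>M. infinite M' \<and> (\<forall>y\<in>M'. n < y) \<and> (\<forall>s\<subseteq>insert n F. rejects T s M')"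
proof (rule ccontr)
  assume no: "\<not> ?thesis"
  have step: "\<exists>s M''. s \<subseteq> F \<and> M'' \<subseteq> M' \<and> infinite M'' \<and> accepts T (insert n s) M''"
    if "n \<in> M" "M' \<subseteq> M" "infinite M'" "\<forall>y\<in>M'. n < y" for n M'
  proof -
    have "\<not> (\<forall>s\<subseteq>insert n F. rejects T s M')"
    proof
      assume "\<forall>s\<subseteq>insert n F. rejects T s M'"
      with that have "\<exists>M'\<subseteq>M. infinite M' \<and> (\<forall>y\<in>M'. n < y) \<and> (\<forall>s\<subseteq>insert n F. rejects T s M')"
        by (intro exI[of _ M'] conjI)
      then have "\<exists>n\<in>M. \<exists>M'\<subseteq>M. infinite M' \<and> (\<forall>y\<in>M'. n < y) \<and> (\<forall>s\<subseteq>insert n F. rejects T s M')"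
        using that(1) by (rule bexI)
      with no show False by (rule notE)
    qed
    then obtain s where s: "s \<subseteq> insert n F" "\<not> rejects T s M'"
      by auto
    have "\<not> s \<subseteq> F"
      using s(2) rej rejects_mono that(2) by blast
    then have eq: "insert n (s - {n}) = s" "s - {n} \<subseteq> F"
      using s(1) by auto
    obtain M'' where "M'' \<subseteq> M'" "infinite M''" "accepts T s M''"
      using s(2) unfolding rejects_def by blast
    moreover from this(3) have "accepts T (insert n (s - {n})) M''"
      using eq(1) by simp
    ultimately show ?thesis
      using eq(2) by (intro exI[of _ "s - {n}"] exI[of _ M'']) simp
  qed
  let ?P = "\<lambda>(n, s, M'). n \<in> M \<and> s \<subseteq> F \<and> M' \<subseteq> M \<and> infinite M' \<and> (\<forall>y\<in>M'. n < y)
     \<and> accepts T (insert n s) M'"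
  let ?Q = "\<lambda>(n, s, M') (n', s', M''). n' \<in> M' \<and> M'' \<subseteq> M'"
  have next_step: "\<exists>z. ?P z \<and> fst z \<in> M' \<and> snd (snd z) \<subseteq> M'" if M': "M' \<subseteq> M" "infinite M'" for M'
  proof -
    obtain n where n: "n \<in> M'"
      using M'(2) by (metis finite.emptyI ex_in_conv)
    have "M' \<inter> {n<..} = M' - {..n}" by auto
    then have inf: "infinite (M' \<inter> {n<..})"
      using M'(2) by (simp add: Diff_infinite_finite)
    obtain s M'' where "s \<subseteq> F" "M'' \<subseteq> M' \<inter> {n<..}" "infinite M''" "accepts T (insert n s) M''"
    proof -
      have "n \<in> M" "M' \<inter> {n<..} \<subseteq> M" "\<forall>y\<in>M' \<inter> {n<..}. n < y"
        using n M' by auto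
      from step[OF this(1,2) inf this(3)] show thesis
        using that by auto
    qed
    then have "?P (n, s, M'')" "n \<in> M'" "M'' \<subseteq> M'"
      using n M' by auto
    then show ?thesis by (intro exI[of _ "(n, s, M'')"]) simp
  qed
  obtain g where g: "\<forall>k. ?P (g k) \<and> ?Q (g k) (g (Suc k))"
  proof (rule exE[OF dependent_nat_choice[of "\<lambda>_. ?P" "\<lambda>_. ?Q"]])
    show "\<exists>x. ?P x" using next_step[of M] M by blast
  next
    fix x :: "nat \<times> nat set \<times> nat set" and k :: nat
    assume "?P x"
    then show "\<exists>y. ?P y \<and> ?Q x y"
      using next_step[of "snd (snd x)"] by (auto simp: case_prod_unfold)
  next
    fix f :: "nat \<Rightarrow> nat \<times> nat set \<times> nat set"
    assume "\<forall>n. ?P (f n) \<and> ?Q (f n) (f (Suc n))"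
    then show thesis by (rule that)
  qed
  define n s N where "n k = fst (g k)" and "s k = fst (snd (g k))" and "N k = snd (snd (g k))" for k
  have gN: "n k \<in> M" "s k \<subseteq> F" "infinite (N k)" "\<forall>y\<in>N k. n k < y"
      "accepts T (insert (n k) (s k)) (N k)" "n (Suc k) \<in> N k" "N (Suc k) \<subseteq> N k" for k
    using spec[OF g, of k] by (auto simp: n_def s_def N_def case_prod_unfold)
  have Nanti: "N j \<subseteq> N i" if "i \<le> j" for i j
    using lift_Suc_antimono_le[of N, OF gN(7)] that by blast
  have nN: "n j \<in> N i" if "i < j" for i j
    using that gN(6)[of "j - 1"] Nanti[of i "j - 1"] by (cases j) auto
  have "strict_mono n"
    unfolding strict_mono_Suc_iff using gN(4,6) by blast
  have "finite (s ` UNIV)"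
    by (rule finite_subset[of _ "Pow F"]) (use gN(2) F in auto)
  then obtain k0 where k0: "infinite {k \<in> UNIV. s k = s k0}"
    using pigeonhole_infinite[of "UNIV :: nat set" s] by auto
  define Z where "Z = n ` {k. s k = s k0}"
  have "infinite Z"
    unfolding Z_def using k0 \<open>strict_mono n\<close>
    by (simp add: finite_image_iff strict_mono_imp_inj_on inj_on_subset)
  moreover have "Z \<subseteq> M"
    unfolding Z_def using gN(1) by auto
  moreover have "accepts T (s k0) Z"
    unfolding accepts_def
  proof (intro allI impI, elim conjE)
    fix L assume L: "L \<subseteq> Z" "infinite L" "\<forall>x\<in>s k0. \<forall>y\<in>L. x < y"
    \<comment> \<open>The least element of \<open>L\<close> is some \<open>n k\<close>, and all
      other elements occur later in the diagonal sequence, hence in \<open>N k\<close>. So the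
      acceptance of \<open>insert (n k) (s k)\<close> by \<open>N k\<close> applies to
      \<open>L - {y}\<close>.\<close>
    define y where "y = (LEAST y. y \<in> L)"
    have yL: "y \<in> L"
      unfolding y_def using L(2) by (metis LeastI finite.emptyI ex_in_conv)
    have ymin: "y \<le> z" if "z \<in> L" for z
      unfolding y_def using that by (rule Least_le)
    obtain k where k: "y = n k" "s k = s k0"
      using yL L(1) unfolding Z_def by auto
    have "L - {y} \<subseteq> N k"
    proof
      fix z assume z: "z \<in> L - {y}"
      then obtain j where j: "z = n j" using L(1) unfolding Z_def by auto
      have "n k < n j" using z ymin[of z] k j by auto
      then have "k < j" using \<open>strict_mono n\<close> by (simp add: strict_mono_less)
      then show "z \<in> N k" using nN j by auto
    qed
    moreover have "infinite (L - {y})" using L(2) by simp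
    moreover have "\<forall>x\<in>insert (n k) (s k). \<forall>z\<in>L - {y}. x < z"
      using L(3) k ymin by (auto simp: less_le)
    ultimately have "init_hit T (insert (n k) (s k) \<union> (L - {y}))"
      using gN(5)[of k] unfolding accepts_def by blast
    moreover have "insert (n k) (s k) \<union> (L - {y}) = s k0 \<union> L"
      using k yL by auto
    ultimately show "init_hit T (s k0 \<union> L)" by simp
  qed
  ultimately show False
    using rej[of "s k0"] gN(2) unfolding rejects_def by blast
qed

text \<open>If \<open>{}\<close> is not rejected, an accepting set already gives the first
  alternative. Otherwise repeated use of \<open>rejects_extend\<close> yields an infinite set whose
  finite subsets are all rejected by some infinite tail.\<close>

lemma open_Ramsey:
  fixes T :: "nat set \<Rightarrow> bool"
  shows "\<exists>H. infinite H \<and> ((\<forall>L\<subseteq>H. infinite L \<longrightarrow> (\<exists>n. T (L \<inter> {..<n}))) \<or> (\<forall>s\<subseteq>H. finite s \<longrightarrow> \<not> T s))"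
proof (cases "rejects T {} UNIV")
  case False
  then obtain N where "infinite N" "accepts T {} N"
    unfolding rejects_def by blast
  then have "infinite N \<and> (\<forall>L\<subseteq>N. infinite L \<longrightarrow> (\<exists>n. T (L \<inter> {..<n})))"
    unfolding accepts_def init_hit_def by simp
  then show ?thesis by blast
next
  case True
  let ?P = "\<lambda>(F, M). finite F \<and> infinite M \<and> (\<forall>s\<subseteq>F. rejects T s M)"
  let ?Q = "\<lambda>(F, M) (F', M'). \<exists>n\<in>M. F' = insert n F \<and> M' \<subseteq> M \<and> (\<forall>y\<in>M'. n < y)"
  obtain g where g: "\<forall>k. ?P (g k) \<and> ?Q (g k) (g (Suc k))"
  proof (rule exE[OF dependent_nat_choice[of "\<lambda>_. ?P" "\<lambda>_. ?Q"]])
    have "?P ({}, UNIV)" using True by auto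
    then show "\<exists>x. ?P x" by blast
  next
    fix x :: "nat set \<times> nat set" and k :: nat
    assume x: "?P x"
    obtain F M where FM: "x = (F, M)" by (cases x)
    obtain n M' where "n \<in> M" "M' \<subseteq> M" "infinite M'" "\<forall>y\<in>M'. n < y" "\<forall>s\<subseteq>insert n F. rejects T s M'"
      using rejects_extend[of F M T] x FM by auto
    then have "?P (insert n F, M') \<and> ?Q x (insert n F, M')"
      using x FM by auto
    then show "\<exists>y. ?P y \<and> ?Q x y" by blast
  next
    fix f :: "nat \<Rightarrow> nat set \<times> nat set"
    assume "\<forall>n. ?P (f n) \<and> ?Q (f n) (f (Suc n))"
    then show thesis by (rule that)
  qed
  define F M where "F k = fst (g k)" and "M k = snd (g k)" for k
  have FM: "finite (F k)" "infinite (M k)" "\<forall>s\<subseteq>F k. rejects T s (M k)"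
    "\<exists>n\<in>M k. F (Suc k) = insert n (F k) \<and> M (Suc k) \<subseteq> M k \<and> (\<forall>y\<in>M (Suc k). n < y)" for k
    using spec[OF g, of k] by (auto simp: F_def M_def case_prod_unfold)
  obtain n where n: "\<And>k. n k \<in> M k" "\<And>k. F (Suc k) = insert (n k) (F k)"
      "\<And>k. M (Suc k) \<subseteq> M k" "\<And>k. \<forall>y\<in>M (Suc k). n k < y"
    using FM(4) by metis
  have "strict_mono n"
    unfolding strict_mono_Suc_iff using n by blast
  then have inf: "infinite (range n)"
    using finite_imageD infinite_UNIV_nat strict_mono_imp_inj_on by blast
  have Fn: "n ` {..<k} \<subseteq> F k" for k
    by (induction k) (auto simp: n(2) lessThan_Suc)
  have "\<not> T s" if s: "s \<subseteq> range n" "finite s" for s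
  proof
    assume "T s"
    obtain D where D: "finite D" "s = n ` D"
      using s finite_subset_image by metis
    then obtain k where "D \<subseteq> {..<k}"
      using finite_nat_iff_bounded by blast
    then have "s \<subseteq> F k" using Fn[of k] D by auto
    then have rej: "rejects T s (M k)" using FM(3) by blast
    \<comment> \<open>A finite set in \<open>T\<close> is accepted by every set: cutting
      \<open>s \<union> L\<close> at the least element of \<open>L\<close> returns \<open>s\<close>
      itself. This contradicts its rejection.\<close>
    have "accepts T s (M k)"
      unfolding accepts_def init_hit_def
    proof (intro allI impI, elim conjE)
      fix L assume L: "infinite L" "\<forall>x\<in>s. \<forall>y\<in>L. x < y"
      define y where "y = (LEAST y. y \<in> L)"
      have "y \<in> L"
        unfolding y_def using L(1) by (metis LeastI finite.emptyI ex_in_conv)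
      moreover have "\<not> z < y" if "z \<in> L" for z
        unfolding y_def using that not_less_Least by blast
      ultimately have "(s \<union> L) \<inter> {..<y} = s"
        using L(2) by auto
      then show "\<exists>n. T ((s \<union> L) \<inter> {..<n})"
        using \<open>T s\<close> by (intro exI[of _ y]) simp
    qed
    then show False
      using rej FM(2) unfolding rejects_def by blast
  qed
  then show ?thesis using inf by blast
qed

section \<open>Ptak's combinatorial lemma\<close>

definition prob_weights :: "(nat \<Rightarrow> real) set" where
  "prob_weights = {w. (\<forall>i. 0 \<le> w i) \<and> finite {i. w i \<noteq> 0} \<and> sum w {i. w i \<noteq> 0} = 1}"

text \<open>Intersecting with the support keeps the index set finite for weights in
  \<open>prob_weights\<close>; \<open>F\<close> itself may be infinite, where \<open>sum\<close>
  would return 0.\<close>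

definition mass :: "(nat \<Rightarrow> real) \<Rightarrow> nat set \<Rightarrow> real" where
  "mass w F = sum w ({i. w i \<noteq> 0} \<inter> F)"

definition avg :: "nat \<Rightarrow> (nat \<Rightarrow> nat \<Rightarrow> real) \<Rightarrow> nat \<Rightarrow> real" where
  "avg m w = (\<lambda>k. (\<Sum>i<m. w i k) / real m)"

text \<open>The invariant of Ptak's argument: the class has members supported arbitrarily far out
  and is closed under uniform averages. Unlike the class of all weights, it can be shrunk repeatedly
  by bounds on masses.\<close>

definition averaging :: "(nat \<Rightarrow> real) set \<Rightarrow> bool" where
  "averaging K \<longleftrightarrow> K \<subseteq> prob_weights \<and> (\<forall>n. \<exists>w\<in>K. \<forall>i<n. w i = 0)
     \<and> (\<forall>m>0. \<forall>w. (\<forall>i<m. w i \<in> K) \<longrightarrow> avg m w \<in> K)"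

lemma mass_superset:
  assumes "finite S" "{i. w i \<noteq> 0} \<subseteq> S"
  shows "mass w F = sum w (S \<inter> F)"
  unfolding mass_def by (rule sum.mono_neutral_left) (use assms in auto)

lemma mass_le_1: "w \<in> prob_weights \<Longrightarrow> mass w F \<le> 1"
  unfolding mass_def prob_weights_def
  by (auto intro: order_trans[OF sum_mono2[of "{i. w i \<noteq> 0}"]])

lemma avg_supp:
  assumes "\<And>i. i < m \<Longrightarrow> w i \<in> prob_weights"
  shows "finite (\<Union>i<m. {k. w i k \<noteq> 0})" "{k. avg m w k \<noteq> 0} \<subseteq> (\<Union>i<m. {k. w i k \<noteq> 0})"
  using assms by (auto simp: prob_weights_def avg_def intro: sum.neutral)

lemma mass_avg:
  assumes "\<And>i. i < m \<Longrightarrow> w i \<in> prob_weights"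
  shows "mass (avg m w) F = (\<Sum>i<m. mass (w i) F) / real m"
proof -
  let ?S = "\<Union>i<m. {k. w i k \<noteq> 0}"
  have "mass (avg m w) F = (\<Sum>k\<in>?S \<inter> F. (\<Sum>i<m. w i k) / real m)"
    using mass_superset[OF avg_supp[OF assms]] by (simp add: avg_def)
  also have "\<dots> = (\<Sum>i<m. \<Sum>k\<in>?S \<inter> F. w i k) / real m"
    by (simp only: sum_divide_distrib[symmetric] sum.swap[of _ "?S \<inter> F"])
  also have "(\<Sum>i<m. \<Sum>k\<in>?S \<inter> F. w i k) = (\<Sum>i<m. mass (w i) F)"
  proof (rule sum.cong[OF refl])
    fix i assume "i \<in> {..<m}"
    then have "{k. w i k \<noteq> 0} \<subseteq> ?S" by blast
    then show "(\<Sum>k\<in>?S \<inter> F. w i k) = mass (w i) F"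
      using mass_superset[OF avg_supp(1)[OF assms]] by simp
  qed
  finally show ?thesis .
qed

lemma averaging_prob_weights: "averaging prob_weights"
proof -
  have 1: "(\<lambda>i. if i = n then 1 else 0) \<in> prob_weights" for n :: nat
    by (auto simp: prob_weights_def)
  have "avg m w \<in> prob_weights" if "m > 0" "\<forall>i<m. w i \<in> prob_weights" for m w
  proof -
    have w: "\<And>i. i < m \<Longrightarrow> w i \<in> prob_weights" using that by blast
    have "sum (avg m w) {k. avg m w k \<noteq> 0} = mass (avg m w) UNIV"
      by (simp add: mass_def)
    also have "\<dots> = (\<Sum>i<m. mass (w i) UNIV) / real m"
      by (rule mass_avg[OF w])
    also have "(\<Sum>i<m. mass (w i) UNIV) = (\<Sum>i<m. 1)"
      by (rule sum.cong) (use w in \<open>auto simp: mass_def prob_weights_def\<close>)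
    finally have "sum (avg m w) {k. avg m w k \<noteq> 0} = 1" using that by simp
    moreover have "\<forall>k. 0 \<le> avg m w k"
      using w by (auto simp: avg_def prob_weights_def intro!: divide_nonneg_nonneg sum_nonneg)
    moreover have "finite {k. avg m w k \<noteq> 0}"
      by (rule finite_subset[OF avg_supp(2) avg_supp(1)]) (use w in auto)
    ultimately show ?thesis unfolding prob_weights_def by blast
  qed
  moreover have "\<exists>w\<in>prob_weights. \<forall>i<n. w i = 0" for n
    by (rule bexI[OF _ 1[of n]]) simp
  ultimately show ?thesis
    unfolding averaging_def by simp
qed

lemma averaging_tail:
  assumes "averaging K" shows "averaging {w\<in>K. \<forall>i<n. w i = 0}"
  unfolding averaging_def
proof (intro conjI allI impI)
  show "{w \<in> K. \<forall>i<n. w i = 0} \<subseteq> prob_weights"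
    using assms by (auto simp: averaging_def)
  show "\<exists>w\<in>{w \<in> K. \<forall>i<n. w i = 0}. \<forall>i<m. w i = 0" for m
  proof -
    obtain w where "w \<in> K" "\<forall>i<max n m. w i = 0"
      using assms unfolding averaging_def by blast
    then show ?thesis by auto
  qed
  show "avg m w \<in> {w \<in> K. \<forall>i<n. w i = 0}"
    if "m > 0" "\<forall>i<m. w i \<in> {w \<in> K. \<forall>i<n. w i = 0}" for m w
    using assms that unfolding averaging_def by (auto simp: avg_def)
qed

text \<open>If every admissible \<open>t\<close> failed, one could choose successive weights in \<open>K\<close> such that each
  gives mass at most \<open>e / 3\<close> to every \<open>F \<supseteq> s\<close> meeting the support of an earlier one. Then each \<open>F\<close> has
  large mass for at most one of them, and a long average contradicts \<open>large\<close>.\<close>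

lemma Ptak_step:
  assumes K: "averaging K" and e: "e > 0" and s: "finite s"
    and large: "\<And>w. w \<in> K \<Longrightarrow> \<exists>F\<in>\<F>. s \<subseteq> F \<and> e \<le> mass w F"
  shows "\<exists>t K' e'. (\<forall>x\<in>s. x < t) \<and> e' > 0 \<and> averaging K' \<and>
           (\<forall>w\<in>K'. \<exists>F\<in>\<F>. insert t s \<subseteq> F \<and> e' \<le> mass w F)"
proof (rule ccontr)
  assume no: "\<not> ?thesis"
  define small where "small D = {w\<in>K. \<forall>t\<in>D. \<forall>F\<in>\<F>. insert t s \<subseteq> F \<longrightarrow> mass w F \<le> e / 3}" for D
  have small: "averaging (small D)" if "finite D" "\<forall>t\<in>D. \<forall>x\<in>s. x < t" for D
    using that
  proof (induction D)
    case empty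
    then show ?case using K by (simp add: small_def)
  next
    case (insert t D)
    then have D: "averaging (small D)" by blast
    have eq: "small (insert t D) = {w\<in>small D. \<forall>F\<in>\<F>. insert t s \<subseteq> F \<longrightarrow> mass w F \<le> e / 3}"
      by (auto simp: small_def)
    show ?case
      unfolding averaging_def
    proof (intro conjI allI impI)
      show "small (insert t D) \<subseteq> prob_weights"
        using K by (auto simp: small_def averaging_def)
      show "\<exists>w\<in>small (insert t D). \<forall>i<n. w i = 0" for n
      proof -
        have av: "averaging {w\<in>small D. \<forall>i<n. w i = 0}"
          by (rule averaging_tail[OF D])
        \<comment> \<open>If every weight of this tail class gave mass at least \<open>e / 3\<close>
          to some \<open>F\<close> containing \<open>insert t s\<close>, then \<open>t\<close>, the
          tail class and \<open>e / 3\<close> would be the triple excluded by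
          \<open>no\<close>.\<close>
        have "\<exists>w\<in>{w\<in>small D. \<forall>i<n. w i = 0}. \<forall>F\<in>\<F>. insert t s \<subseteq> F \<longrightarrow> mass w F < e / 3"
        proof (rule ccontr)
          assume "\<not> ?thesis"
          then have "\<forall>w\<in>{w\<in>small D. \<forall>i<n. w i = 0}. \<exists>F\<in>\<F>. insert t s \<subseteq> F \<and> e / 3 \<le> mass w F"
            by (meson not_less)
          moreover have "\<forall>x\<in>s. x < t" "e / 3 > 0" using insert.prems e by auto
          ultimately show False using no av by blast
        qed
        then show ?thesis unfolding eq by (force intro: less_imp_le)
      qed
      show "avg m w \<in> small (insert t D)" if "m > 0" "\<forall>i<m. w i \<in> small (insert t D)" for m w
      proof -
        have wp: "w i \<in> prob_weights" if "i < m" for i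
          using K that \<open>\<forall>i<m. _\<close> by (auto simp: small_def averaging_def)
        have "mass (avg m w) F \<le> e / 3" if F: "F \<in> \<F>" "insert t s \<subseteq> F" for F
        proof -
          have "(\<Sum>i<m. mass (w i) F) \<le> (\<Sum>i<m. e / 3)"
            by (rule sum_mono) (use that \<open>\<forall>i<m. _\<close> in \<open>auto simp: small_def\<close>)
          then show ?thesis
            using \<open>m > 0\<close> by (simp add: mass_avg[OF wp] field_simps)
        qed
        moreover have "avg m w \<in> small D"
          using D that unfolding eq averaging_def by blast
        ultimately show ?thesis unfolding eq by blast
      qed
    qed
  qed
  \<comment> \<open>Weights supported from \<open>n0\<close> on have only admissible
    \<open>t\<close> in their supports. Inserting 0 keeps \<open>Max\<close> meaningful for empty
    \<open>s\<close>.\<close>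
  define n0 where "n0 = Suc (Max (insert 0 s))"
  have n0: "\<forall>x\<in>s. x < t" if "n0 \<le> t" for t
    using s that unfolding n0_def by (auto simp: Suc_le_eq less_le_trans le_less_trans Max_ge)
  let ?P = "\<lambda>(w, D). w \<in> K \<and> finite D \<and> (\<forall>t\<in>D. n0 \<le> t) \<and> {i. w i \<noteq> 0} \<subseteq> D"
  let ?Q = "\<lambda>(w, D) (w', D'). w' \<in> small D \<and> D \<subseteq> D'"
  have next_step: "\<exists>z. ?P z \<and> fst z \<in> small D \<and> D \<subseteq> snd z" if "finite D" "\<forall>t\<in>D. n0 \<le> t" for D
  proof -
    have "averaging (small D)" by (rule small) (use that n0 in auto)
    then obtain w where w: "w \<in> small D" "\<forall>i<n0. w i = 0"
      unfolding averaging_def by blast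
    then have "w \<in> K" by (simp add: small_def)
    then have "finite {i. w i \<noteq> 0}" using K by (auto simp: averaging_def prob_weights_def)
    then have "?P (w, D \<union> {i. w i \<noteq> 0})"
      using w that \<open>w \<in> K\<close> by (auto simp: not_less[symmetric])
    then show ?thesis using w(1) by (intro exI[of _ "(w, D \<union> {i. w i \<noteq> 0})"]) auto
  qed
  obtain g where g: "\<forall>k. ?P (g k) \<and> ?Q (g k) (g (Suc k))"
  proof (rule exE[OF dependent_nat_choice[of "\<lambda>_. ?P" "\<lambda>_. ?Q"]])
    show "\<exists>x. ?P x" using next_step[of "{}"] by blast
  next
    fix x :: "(nat \<Rightarrow> real) \<times> nat set" and k :: nat
    assume "?P x"
    then show "\<exists>y. ?P y \<and> ?Q x y"
      using next_step[of "snd x"] by (auto simp: case_prod_unfold)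
  next
    fix f :: "nat \<Rightarrow> (nat \<Rightarrow> real) \<times> nat set"
    assume "\<forall>n. ?P (f n) \<and> ?Q (f n) (f (Suc n))"
    then show thesis by (rule that)
  qed
  define w D where "w k = fst (g k)" and "D k = snd (g k)" for k
  have wD: "w k \<in> K" "{i. w k i \<noteq> 0} \<subseteq> D k" "w (Suc k) \<in> small (D k)" "D k \<subseteq> D (Suc k)" for k
    using spec[OF g, of k] by (auto simp: w_def D_def case_prod_unfold)
  have wp: "w k \<in> prob_weights" for k
    using wD(1) K by (auto simp: averaging_def)
  have Dmono: "D i \<subseteq> D j" if "i \<le> j" for i j
    using lift_Suc_mono_le[of D, OF wD(4)] that by blast
  \<comment> \<open>At most one weight gives \<open>F\<close> mass above \<open>e / 3\<close>, so
    the total over \<open>m\<close> weights is at most \<open>m * e / 3 + 1\<close>. This is less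
    than \<open>e * m\<close> once \<open>e * m > 3\<close>.\<close>
  obtain m :: nat where m: "real m > 3 / e"
    using reals_Archimedean2 by blast
  then have "m > 0" using e by (metis divide_pos_pos gr0I less_asym of_nat_0 zero_less_numeral)
  then have "avg m w \<in> K"
    using K wD(1) unfolding averaging_def by blast
  then obtain F where F: "F \<in> \<F>" "s \<subseteq> F" "e \<le> mass (avg m w) F"
    using large by blast
  \<comment> \<open>A mass above \<open>e / 3\<close> is positive, so \<open>F\<close> meets the
    support of \<open>w i\<close> in some \<open>t\<close>. That support lies in
    \<open>D j'\<close>, and \<open>w j\<close> was chosen in \<open>small (D j')\<close>.\<close>
  have once: "mass (w j) F \<le> e / 3" if ij: "i < j" "mass (w i) F > e / 3" for i j
  proof -
    have "{k. w i k \<noteq> 0} \<inter> F \<noteq> {}"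
      using ij(2) e unfolding mass_def by force
    then obtain t where t: "t \<in> F" "w i t \<noteq> 0" by blast
    obtain j' where j': "j = Suc j'" using ij(1) by (cases j) auto
    have "t \<in> D j'" using t(2) wD(2)[of i] Dmono[of i j'] ij(1) j' by auto
    moreover have "w j \<in> small (D j')" using wD(3) j' by simp
    ultimately show ?thesis using t(1) F unfolding small_def by auto
  qed
  \<comment> \<open>If no index is heavy, \<open>LEAST\<close> returns an unspecified value; the
    bound below then holds without the extra 1.\<close>
  define i0 where "i0 = (LEAST i. mass (w i) F > e / 3)"
  have "mass (w i) F \<le> e / 3 + (if i = i0 then 1 else 0)" for i
  proof (cases "mass (w i) F > e / 3")
    case True
    then have "mass (w i0) F > e / 3" "i0 \<le> i"
      unfolding i0_def by (rule LeastI, rule Least_le)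
    then have "i = i0" using once[of i0 i] True by (cases "i = i0") auto
    then show ?thesis using mass_le_1[OF wp, of i F] e by simp
  qed auto
  then have "(\<Sum>i<m. mass (w i) F) \<le> (\<Sum>i<m. e / 3 + (if i = i0 then 1 else 0))"
    by (intro sum_mono)
  also have "\<dots> \<le> real m * (e / 3) + 1"
    by (simp add: sum.distrib)
  finally have "e * real m \<le> real m * (e / 3) + 1"
    using F(3) mass_avg[OF wp] \<open>m > 0\<close> by (simp add: field_simps)
  moreover have "e * real m > 3" using m e by (simp add: field_simps)
  ultimately show False by (simp add: field_simps)
qed

text \<open>\<open>Ptak_step\<close> adds one point at a time to \<open>s\<close>. Its averaging
  class and its positive bound may change at each stage; any member of the class still exhibits an
  \<open>F\<close> containing the points collected so far.\<close>

lemma Ptak_combinatorial: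
  assumes e: "e > 0" and large: "\<And>w. w \<in> prob_weights \<Longrightarrow> \<exists>F\<in>\<F>. e \<le> mass w F"
  shows "\<exists>J. infinite J \<and> (\<forall>S\<subseteq>J. finite S \<longrightarrow> (\<exists>F\<in>\<F>. S \<subseteq> F))"
proof -
  let ?P = "\<lambda>s. finite s \<and> (\<exists>K e'. e' > 0 \<and> averaging K \<and> (\<forall>w\<in>K. \<exists>F\<in>\<F>. s \<subseteq> F \<and> e' \<le> mass w F))"
  let ?Q = "\<lambda>s s'. \<exists>t. t \<notin> s \<and> s' = insert t s"
  obtain s where s0: "\<forall>k. ?P (s k) \<and> ?Q (s k) (s (Suc k))"
  proof (rule exE[OF dependent_nat_choice[of "\<lambda>_. ?P" "\<lambda>_. ?Q"]])
    have "?P {}" using e large averaging_prob_weights by auto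
    then show "\<exists>x. ?P x" by blast
  next
    fix x :: "nat set" and k :: nat
    assume x: "?P x"
    then obtain K e' where "finite x" "e' > 0" "averaging K"
      "\<And>w. w \<in> K \<Longrightarrow> \<exists>F\<in>\<F>. x \<subseteq> F \<and> e' \<le> mass w F" by blast
    from Ptak_step[OF this(3,2,1,4)]
    obtain t K' e'' where "\<forall>y\<in>x. y < t" "?P (insert t x)" using x by blast
    then have "?P (insert t x) \<and> ?Q x (insert t x)" by blast
    then show "\<exists>y. ?P y \<and> ?Q x y" by blast
  next
    fix f :: "nat \<Rightarrow> nat set"
    assume "\<forall>n. ?P (f n) \<and> ?Q (f n) (f (Suc n))"
    then show thesis by (rule that)
  qed
  have s: "?P (s k)" "?Q (s k) (s (Suc k))" for k
    using spec[OF s0, of k] by blast+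
  have smono: "s i \<subseteq> s j" if "i \<le> j" for i j
    by (rule lift_Suc_mono_le[of s, OF _ that]) (use s(2) in blast)
  have card: "k \<le> card (s k)" for k
  proof (induction k)
    case (Suc k)
    obtain t where "t \<notin> s k" "s (Suc k) = insert t (s k)" using s(2) by blast
    then show ?case using Suc s(1)[of k] by simp
  qed simp
  have "infinite (\<Union>k. s k)"
  proof
    assume "finite (\<Union>k. s k)"
    then have "card (s (Suc (card (\<Union>k. s k)))) \<le> card (\<Union>k. s k)"
      by (intro card_mono) auto
    then show False using card[of "Suc (card (\<Union>k. s k))"] by simp
  qed
  moreover have "\<exists>F\<in>\<F>. S \<subseteq> F" if S: "S \<subseteq> (\<Union>k. s k)" "finite S" for S
  proof -
    have "\<exists>k. S \<subseteq> s k"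
      using S(2,1)
    proof (induction S)
      case (insert x S)
      then obtain k l where "S \<subseteq> s k" "x \<in> s l" by blast
      then have "insert x S \<subseteq> s (max k l)" using smono[of k "max k l"] smono[of l "max k l"] by auto
      then show ?case by blast
    qed auto
    then obtain k where k: "S \<subseteq> s k" by blast
    obtain K e' where K: "averaging K" "\<forall>w\<in>K. \<exists>F\<in>\<F>. s k \<subseteq> F \<and> e' \<le> mass w F"
      using s(1)[of k] by blast
    then obtain w where "w \<in> K" unfolding averaging_def by blast
    then obtain F where "F \<in> \<F>" "s k \<subseteq> F" using K(2) by blast
    then show ?thesis using k order_trans by (intro bexI[of _ F]) auto
  qed
  ultimately show ?thesis by blast
qed

section \<open>Independent subsequences from averaged gaps\<close>

text \<open>A pattern \<open>(P\<^sub>0, N\<^sub>0)\<close> that \<open>g\<close> fails to realise can be adjoined to every pattern supported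
  beyond it, so that \<open>g\<close> becomes superfluous on that tail.\<close>

lemma tail_of_finite_cover:
  fixes R :: "'g \<Rightarrow> nat set \<Rightarrow> nat set \<Rightarrow> bool"
  assumes "finite G"
    and mono: "\<And>g P N P' N'. R g P' N' \<Longrightarrow> P \<subseteq> P' \<Longrightarrow> N \<subseteq> N' \<Longrightarrow> R g P N"
    and cover: "\<And>P N. finite P \<Longrightarrow> finite N \<Longrightarrow> P \<inter> N = {} \<Longrightarrow> P \<union> N \<subseteq> {m..} \<Longrightarrow> \<exists>g\<in>G. R g P N"
  shows "\<exists>g\<in>G. \<exists>m. \<forall>P N. finite P \<and> finite N \<and> P \<inter> N = {} \<and> P \<union> N \<subseteq> {m..} \<longrightarrow> R g P N"
  using assms(1) cover
proof (induction G arbitrary: m)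
  case empty
  then show ?case by (metis Int_empty_left Un_empty_left empty_iff empty_subsetI finite.emptyI)
next
  case (insert g G)
  show ?case
  proof (cases "\<forall>P N. finite P \<and> finite N \<and> P \<inter> N = {} \<and> P \<union> N \<subseteq> {m..} \<longrightarrow> R g P N")
    case True
    then show ?thesis by blast
  next
    case False
    then obtain P0 N0 where PN0: "finite P0" "finite N0" "P0 \<inter> N0 = {}" "P0 \<union> N0 \<subseteq> {m..}" "\<not> R g P0 N0"
      by blast
    then obtain m0 where m0: "P0 \<union> N0 \<subseteq> {..<m0}"
      using finite_nat_iff_bounded by (metis finite_Un)
    have "\<exists>g\<in>G. \<exists>m. \<forall>P N. finite P \<and> finite N \<and> P \<inter> N = {} \<and> P \<union> N \<subseteq> {m..} \<longrightarrow> R g P N"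
    proof (rule insert.IH)
      fix P N :: "nat set"
      assume PN: "finite P" "finite N" "P \<inter> N = {}" "P \<union> N \<subseteq> {max m m0..}"
      have "(P \<union> P0) \<inter> (N \<union> N0) = {}"
        using PN(3,4) PN0(3) m0 by force
      moreover have "(P \<union> P0) \<union> (N \<union> N0) \<subseteq> {m..}"
        using PN(4) PN0(4) by auto
      ultimately obtain h where h: "h \<in> insert g G" "R h (P \<union> P0) (N \<union> N0)"
        using insert.prems[of "P \<union> P0" "N \<union> N0"] PN PN0 by auto
      then have "h \<noteq> g"
        using mono[of h "P \<union> P0" "N \<union> N0" P0 N0] PN0(5) by auto
      then show "\<exists>g\<in>G. R g P N"
        using h mono[of h "P \<union> P0" "N \<union> N0" P N] by auto
    qed
    then show ?thesis by blast
  qed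
qed

text \<open>Positions are counted inside \<open>s\<close>, so alternation passes to initial segments
  but not to arbitrary subsets. Requiring it for all finite subsets of a set is therefore a strong
  condition, with the witness free to vary.\<close>

definition alternating :: "(nat \<Rightarrow> 'k \<Rightarrow> real) \<Rightarrow> real \<Rightarrow> real \<Rightarrow> 'k \<Rightarrow> nat set \<Rightarrow> bool" where
  "alternating f p q x s \<longleftrightarrow>
     (\<forall>n\<in>s. if even (card (s \<inter> {..<n})) then f n x < p else q < f n x)"

lemma alternating_image:
  fixes r :: "nat \<Rightarrow> nat"
  assumes r: "strict_mono r"
  shows "alternating f p q x (r ` D) \<longleftrightarrow>
     (\<forall>k\<in>D. if even (card (D \<inter> {..<k})) then f (r k) x < p else q < f (r k) x)"
proof -
  have "card (r ` D \<inter> {..<r k}) = card (D \<inter> {..<k})" for k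
  proof -
    have "r ` D \<inter> {..<r k} = r ` (D \<inter> {..<k})"
      using strict_mono_less[OF r] by auto
    then show ?thesis
      using card_image strict_mono_imp_inj_on[OF r] inj_on_subset by (metis subset_UNIV)
  qed
  then show ?thesis unfolding alternating_def by simp
qed

text \<open>In a union of pairs \<open>{2 * j, 2 * j + 1}\<close> every even element has even
  position and every odd element odd position. Membership of \<open>j\<close> in a jump set thus
  becomes alternation.\<close>

lemma even_card_paired: "even (card ({i. i div 2 \<in> J} \<inter> {..<2 * j}))" for J :: "nat set"
proof (induction j)
  case (Suc j)
  have eq: "{i. i div 2 \<in> J} \<inter> {..<2 * Suc j} =
      ({i. i div 2 \<in> J} \<inter> {..<2 * j}) \<union> (if j \<in> J then {2 * j, Suc (2 * j)} else {})"
    by (auto simp: less_Suc_eq)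
  have "card ({i. i div 2 \<in> J} \<inter> {..<2 * Suc j}) =
      card ({i. i div 2 \<in> J} \<inter> {..<2 * j}) + (if j \<in> J then 2 else 0)"
    unfolding eq by (subst card_Un_disjoint) auto
  then show ?case using Suc by simp
qed simp

text \<open>Each \<open>i\<close> contributes two points to \<open>pattern_set P\<close>, which keeps parities in step, and
  \<open>3 * i + 1\<close> has an even number of predecessors in the set exactly when \<open>i \<in> P\<close>.\<close>

definition pattern_set :: "nat set \<Rightarrow> nat set" where
  "pattern_set P = {k. if k div 3 \<in> P then k mod 3 \<noteq> 0 else k mod 3 \<noteq> 2}"

lemma card_pattern_set: "card (pattern_set P \<inter> {..<3 * i}) = 2 * i"
proof (induction i)
  case (Suc i)
  have less3: "k < 3 * Suc i \<longleftrightarrow> k < 3 * i \<or> k = 3 * i \<or> k = 3 * i + 1 \<or> k = 3 * i + 2" for k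
    by auto
  have eq: "pattern_set P \<inter> {..<3 * Suc i} = (pattern_set P \<inter> {..<3 * i})
      \<union> (if i \<in> P then {3 * i + 1, 3 * i + 2} else {3 * i, 3 * i + 1})"
  proof -
    have "(3 * i + 2) div 3 = i" "(3 * i + 2) mod 3 = 2" by presburger+
    then show ?thesis
      unfolding pattern_set_def set_eq_iff Int_iff lessThan_iff less3 by auto
  qed
  show ?case
    unfolding eq by (subst card_Un_disjoint) (use Suc in auto)
qed simp

lemma pattern_set_parity:
  assumes "i < m"
  shows "3 * i + 1 \<in> pattern_set P \<inter> {..<3 * m}"
    "even (card (pattern_set P \<inter> {..<3 * m} \<inter> {..<3 * i + 1})) \<longleftrightarrow> i \<in> P"
proof -
  show "3 * i + 1 \<in> pattern_set P \<inter> {..<3 * m}"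
    using assms by (auto simp: pattern_set_def)
  have "pattern_set P \<inter> {..<3 * m} \<inter> {..<3 * i + 1} =
      pattern_set P \<inter> {..<3 * i} \<union> (if i \<in> P then {} else {3 * i})"
    using assms by (auto simp: less_Suc_eq pattern_set_def)
  then have "card (pattern_set P \<inter> {..<3 * m} \<inter> {..<3 * i + 1}) = (if i \<in> P then 2 * i else 2 * i + 1)"
    using card_pattern_set[of P i] by simp
  then show "even (card (pattern_set P \<inter> {..<3 * m} \<inter> {..<3 * i + 1})) \<longleftrightarrow> i \<in> P"
    by simp
qed

text \<open>The pairs are neighbouring multiples of \<open>h\<close>. The first multiple above
  \<open>u\<close> is at most \<open>u + h\<close>, its successor at most \<open>u + 2 * h\<close>,
  and a gap of \<open>3 * h\<close> keeps the latter strictly below \<open>v\<close>.\<close>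

lemma finite_separating_grid:
  fixes h C :: real
  assumes h: "h > 0"
  shows "\<exists>G. finite G \<and> (\<forall>(p, q)\<in>G. p < q) \<and>
     (\<forall>u v. \<bar>u\<bar> \<le> C \<and> 3 * h \<le> v - u \<longrightarrow> (\<exists>(p, q)\<in>G. u < p \<and> q < v))"
proof (intro exI conjI allI impI; (elim conjE)?)
  let ?G = "(\<lambda>i::int. (of_int i * h, of_int (i + 1) * h)) ` {\<lfloor>- C / h\<rfloor>..\<lfloor>C / h\<rfloor> + 1}"
  show "finite ?G" by simp
  show "\<forall>(p, q)\<in>?G. p < q" using h by (auto simp: field_simps)
  fix u v assume uv: "\<bar>u\<bar> \<le> C" "3 * h \<le> v - u"
  define i where "i = \<lfloor>u / h\<rfloor> + 1"
  have i: "u < of_int i * h" "of_int i * h \<le> u + h"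
  proof -
    have "u / h < of_int i" "of_int i \<le> u / h + 1" unfolding i_def by linarith+
    then show "u < of_int i * h" "of_int i * h \<le> u + h" using h by (auto simp: field_simps)
  qed
  have "- C / h \<le> u / h" "u / h \<le> C / h"
    by (rule divide_right_mono; use uv(1) h in linarith)+
  then have "i \<in> {\<lfloor>- C / h\<rfloor>..\<lfloor>C / h\<rfloor> + 1}"
    using floor_mono[of "- C / h" "u / h"] floor_mono[of "u / h" "C / h"] unfolding i_def by simp
  moreover have "of_int (i + 1) * h < v"
    using i(2) uv(2) h by (simp add: distrib_right)
  ultimately show "\<exists>(p, q)\<in>?G. u < p \<and> q < v"
    using i(1) by (intro bexI[of _ "(of_int i * h, of_int (i + 1) * h)"]) auto
qed

text \<open>By the Ramsey theorem, pass to an infinite \<open>H\<close>. If all its finite subsets are alternating for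
  some thresholds in the grid \<open>G\<close>, every third element of \<open>H\<close> gives independence. The other alternative of
  the Ramsey theorem is refuted by applying Ptak's lemma to the sets of indices \<open>j\<close> at which
  \<open>f\<close> jumps over a pair of \<open>G\<close> between the elements \<open>2 * j\<close> and \<open>2 * j + 1\<close> of \<open>H\<close>.\<close>

theorem independent_subseq_of_averaged_gap:
  fixes f :: "nat \<Rightarrow> 'k \<Rightarrow> real"
  assumes bound: "\<And>n x. x \<in> K \<Longrightarrow> \<bar>f n x\<bar> \<le> C" and d: "d > 0"
    and gap: "\<And>S w (r :: nat \<Rightarrow> nat). finite (S :: nat set) \<Longrightarrow> \<forall>j\<in>S. 0 \<le> w j \<Longrightarrow> sum w S = 1 \<Longrightarrow> strict_mono r \<Longrightarrow>
      \<exists>x\<in>K. d \<le> (\<Sum>j\<in>S. w j * (f (r (2 * j + 1)) x - f (r (2 * j)) x))"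
  shows "\<exists>r. strict_mono r \<and> independent_seq (\<lambda>n. f (r n)) K"
proof -
  \<comment> \<open>The mesh \<open>d / 6\<close> makes jumps of size \<open>d / 2\<close>
    detectable by the grid; smaller jumps account for at most half of the average
    \<open>d\<close>.\<close>
  obtain G where G: "finite G" "\<forall>(p, q)\<in>G. p < q"
    "\<And>u v. \<bar>u\<bar> \<le> C \<Longrightarrow> d / 2 \<le> v - u \<Longrightarrow> \<exists>(p, q)\<in>G. u < p \<and> q < v"
    using finite_separating_grid[of "d / 6" C] d by auto
  \<comment> \<open>\<open>T\<close> is the failure of alternation, so the desired alternative of
    the Ramsey theorem is the one in which no finite subset of \<open>H\<close> satisfies
    \<open>T\<close>.\<close>
  define T where "T s \<longleftrightarrow> \<not> (\<exists>(p, q)\<in>G. \<exists>x\<in>K. alternating f p q x s)" for s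
  obtain H where H: "infinite H"
    "(\<forall>L\<subseteq>H. infinite L \<longrightarrow> (\<exists>n. T (L \<inter> {..<n}))) \<or> (\<forall>s\<subseteq>H. finite s \<longrightarrow> \<not> T s)"
    using open_Ramsey[of T] by blast
  define r where "r = enumerate H"
  have r: "strict_mono r" "range r = H"
    unfolding r_def using H(1) strict_mono_enumerate range_enumerate by auto
  have not_hit: "\<exists>L\<subseteq>H. infinite L \<and> (\<forall>n. \<not> T (L \<inter> {..<n}))"
  proof -
    define F where "F x g = {j. f (r (2 * j)) x < fst g \<and> snd g < f (r (2 * j + 1)) x}" for x and g :: "real \<times> real"
    define C' where "C' = \<bar>C\<bar> + 1"
    \<comment> \<open>If all masses were below \<open>e\<close>, the bound \<open>low\<close> would
      give \<open>d / 2 \<le> 2 * C' * card G * e\<close>, at most \<open>d / 4\<close>. Adding 1 to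
      \<open>card G\<close> keeps the denominator positive.\<close>
    define e where "e = d / (8 * C' * (real (card G) + 1))"
    have C': "C' > 0" "\<And>n x. x \<in> K \<Longrightarrow> \<bar>f n x\<bar> \<le> C'"
      unfolding C'_def using bound by (force, smt)
    have e: "e > 0" unfolding e_def using d C' by simp
    have "\<exists>F'\<in>{F x g | x g. x \<in> K \<and> g \<in> G}. e \<le> mass w F'" if w: "w \<in> prob_weights" for w
    proof -
      let ?S = "{i. w i \<noteq> 0}"
      have S: "finite ?S" "\<forall>j\<in>?S. 0 \<le> w j" "sum w ?S = 1"
        using w by (auto simp: prob_weights_def)
      obtain x where x: "x \<in> K" "d \<le> (\<Sum>j\<in>?S. w j * (f (r (2 * j + 1)) x - f (r (2 * j)) x))"
        using gap[OF S r(1)] by blast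
      \<comment> \<open>A difference of at least \<open>d / 2\<close> crosses a grid pair, so the
        sum of indicators is at least 1, and \<open>2 * C'\<close> bounds any difference.\<close>
      have jump: "f (r (2 * j + 1)) x - f (r (2 * j)) x \<le> d / 2 + 2 * C' * (\<Sum>g\<in>G. if j \<in> F x g then 1 else 0)" for j
      proof (cases "d / 2 \<le> f (r (2 * j + 1)) x - f (r (2 * j)) x")
        case True
        then obtain g where g: "g \<in> G" "j \<in> F x g"
          using G(3)[of "f (r (2 * j)) x" "f (r (2 * j + 1)) x"] bound[OF x(1)] by (fastforce simp: F_def)
        have "(\<Sum>g\<in>{g}. if j \<in> F x g then 1 else 0) \<le> (\<Sum>g\<in>G. if j \<in> F x g then 1 else (0::real))"
          by (rule sum_mono2) (use g G in auto)
        then have "1 \<le> (\<Sum>g\<in>G. if j \<in> F x g then 1 else (0::real))" using g by simp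
        then have "2 * C' * 1 \<le> 2 * C' * (\<Sum>g\<in>G. if j \<in> F x g then 1 else 0)"
          using C'(1) by (intro mult_left_mono) auto
        then show ?thesis
          using C'(2)[OF x(1), of "r (2 * j + 1)"] C'(2)[OF x(1), of "r (2 * j)"] d by linarith
      next
        case False
        moreover have "0 \<le> 2 * C' * (\<Sum>g\<in>G. if j \<in> F x g then 1 else 0)"
          using C'(1) by (intro mult_nonneg_nonneg sum_nonneg) auto
        ultimately show ?thesis by linarith
      qed
      have mass_eq: "mass w (F x g) = (\<Sum>j\<in>?S. w j * (if j \<in> F x g then 1 else 0))" for g
        unfolding mass_def using S(1) by (simp add: sum.inter_restrict if_distrib cong: if_cong)
      have "d \<le> (\<Sum>j\<in>?S. w j * (d / 2 + 2 * C' * (\<Sum>g\<in>G. if j \<in> F x g then 1 else 0)))"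
        by (rule order_trans[OF x(2)]) (intro sum_mono mult_left_mono jump; use S(2) in blast)
      also have "\<dots> = (\<Sum>j\<in>?S. w j * (d / 2) + 2 * C' * (\<Sum>g\<in>G. w j * (if j \<in> F x g then 1 else 0)))"
        by (rule sum.cong[OF refl]) (simp add: sum_distrib_left algebra_simps)
      also have "\<dots> = sum w ?S * (d / 2) + 2 * C' * (\<Sum>j\<in>?S. \<Sum>g\<in>G. w j * (if j \<in> F x g then 1 else 0))"
        by (simp only: sum.distrib sum_distrib_left sum_distrib_right)
      also have "(\<Sum>j\<in>?S. \<Sum>g\<in>G. w j * (if j \<in> F x g then 1 else 0)) = (\<Sum>g\<in>G. mass w (F x g))"
        unfolding mass_eq by (rule sum.swap)
      finally have low: "d / 2 \<le> 2 * C' * (\<Sum>g\<in>G. mass w (F x g))"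
        using S(3) by simp
      have "\<exists>g\<in>G. e \<le> mass w (F x g)"
      proof (rule ccontr)
        assume "\<not> ?thesis"
        then have "(\<Sum>g\<in>G. mass w (F x g)) \<le> (\<Sum>g\<in>G. e)"
          by (intro sum_mono) auto
        then have "2 * C' * (\<Sum>g\<in>G. mass w (F x g)) \<le> 2 * C' * (\<Sum>g\<in>G. e)"
          using C'(1) by (intro mult_left_mono) auto
        then have "d / 2 \<le> 2 * C' * (real (card G) * e)"
          using low by simp
        also have "\<dots> \<le> 2 * C' * ((real (card G) + 1) * e)"
          using C'(1) e by (intro mult_left_mono mult_right_mono) auto
        also have "\<dots> = d / 4"
        proof -
          have "2 * c * (k * (d / (8 * c * k))) = d / 4" if "c \<noteq> 0" "k \<noteq> 0" for c k :: real
            using that by (simp add: field_simps)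
          then show ?thesis unfolding e_def using C'(1) by (simp add: add_nonneg_eq_0_iff)
        qed
        finally show False using d by simp
      qed
      then show ?thesis using x(1) by blast
    qed
    from Ptak_combinatorial[OF e this]
    obtain J where J: "infinite J"
      "\<forall>S\<subseteq>J. finite S \<longrightarrow> (\<exists>F'\<in>{F x g | x g. x \<in> K \<and> g \<in> G}. S \<subseteq> F')"
      by blast
    define D where "D = {k. k div 2 \<in> J}"
    have infD: "infinite D"
    proof
      assume "finite D"
      moreover have "J \<subseteq> (\<lambda>k. k div 2) ` D"
      proof
        fix j assume "j \<in> J"
        then show "j \<in> (\<lambda>k. k div 2) ` D" by (intro image_eqI[of _ _ "2 * j"]) (auto simp: D_def)
      qed
      ultimately show False using J(1) finite_surj by blast
    qed
    have infL: "infinite (r ` D)"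
      using infD r(1) by (simp add: finite_image_iff strict_mono_imp_inj_on inj_on_subset)
    have "\<not> T (r ` D \<inter> {..<n})" for n
    proof -
      \<comment> \<open>Ptak's lemma handles finite subsets of \<open>J\<close>. The listed
        \<open>j\<close> cover all pairs meeting the initial segment; the cut at \<open>n\<close>
        may retain only the even member of a pair, which does not disturb the positions before
        it.\<close>
      have fin: "finite {j\<in>J. r (2 * j) < n}"
      proof (rule finite_subset)
        show "{j\<in>J. r (2 * j) < n} \<subseteq> {..<n}"
        proof
          fix j assume "j \<in> {j\<in>J. r (2 * j) < n}"
          then have "2 * j \<le> r (2 * j)" "r (2 * j) < n"
            using strict_mono_imp_increasing[OF r(1)] by auto
          then have "j < n" by linarith
          then show "j \<in> {..<n}" by simp
        qed
      qed simp
      then obtain x g where xg: "x \<in> K" "g \<in> G" "{j\<in>J. r (2 * j) < n} \<subseteq> F x g"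
        using J(2)[rule_format, OF _ fin] by blast
      define D' where "D' = {k\<in>D. r k < n}"
      have eq: "r ` D \<inter> {..<n} = r ` D'" by (auto simp: D'_def)
      have "if even (card (D' \<inter> {..<k})) then f (r k) x < fst g else snd g < f (r k) x" if k: "k \<in> D'" for k
      proof -
        have eqk: "D' \<inter> {..<k} = D \<inter> {..<k}"
          using k strict_mono_less[OF r(1)] unfolding D'_def by (auto intro: less_trans)
        have kJ: "k div 2 \<in> J" "r k < n" using k by (auto simp: D'_def D_def)
        have "r (2 * (k div 2)) \<le> r k"
          using strict_mono_less_eq[OF r(1)] by simp
        then have kF: "k div 2 \<in> F x g" using xg(3) kJ by auto
        show ?thesis
        proof (cases "even k")
          case True
          then have "k = 2 * (k div 2)" by simp
          then have "even (card (D' \<inter> {..<k}))"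
            unfolding eqk D_def using even_card_paired[of J "k div 2"] by simp
          then show ?thesis using kF True by (simp add: F_def)
        next
          case False
          then have k2: "k = Suc (2 * (k div 2))" by simp
          have "D \<inter> {..<k} = insert (2 * (k div 2)) (D \<inter> {..<2 * (k div 2)})"
            using kJ(1) by (subst k2) (auto simp: D_def less_Suc_eq)
          then have "card (D \<inter> {..<k}) = Suc (card (D \<inter> {..<2 * (k div 2)}))" by simp
          then have "odd (card (D' \<inter> {..<k}))"
            unfolding eqk D_def using even_card_paired[of J "k div 2"] by simp
          then show ?thesis using kF False by (simp add: F_def)
        qed
      qed
      then have "alternating f (fst g) (snd g) x (r ` D')"
        unfolding alternating_image[OF r(1)] by blast
      then have "\<exists>(p, q)\<in>G. \<exists>x\<in>K. alternating f p q x (r ` D')"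
        using xg(1,2) by (intro bexI[of _ g]) (auto simp: case_prod_unfold)
      then show ?thesis unfolding T_def eq by blast
    qed
    then show ?thesis using infL r(2) by blast
  qed
  then have noT: "\<And>s. s \<subseteq> H \<Longrightarrow> finite s \<Longrightarrow> \<not> T s"
    using H(2) by metis
  define R where "R g P N \<longleftrightarrow> (\<exists>x\<in>K. (\<forall>n\<in>P. f (r (3 * n + 1)) x < fst g) \<and> (\<forall>n\<in>N. snd g < f (r (3 * n + 1)) x))"
    for g :: "real \<times> real" and P N :: "nat set"
  \<comment> \<open>So far the thresholds depend on the pattern. Finiteness of \<open>G\<close>
    fixes one pair for all patterns beyond some \<open>m\<close>, which is the origin of the shift
    in \<open>?r\<close>.\<close>
  have "\<exists>g\<in>G. \<exists>m. \<forall>P N. finite P \<and> finite N \<and> P \<inter> N = {} \<and> P \<union> N \<subseteq> {m..} \<longrightarrow> R g P N"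
  proof (rule tail_of_finite_cover[OF G(1)])
    show "R g P N" if "R g P' N'" "P \<subseteq> P'" "N \<subseteq> N'" for g P N P' N'
      using that unfolding R_def by blast
  next
    fix P N :: "nat set"
    assume PN: "finite P" "finite N" "P \<inter> N = {}"
    then obtain m where m: "P \<union> N \<subseteq> {..<m}"
      using finite_nat_iff_bounded by (metis finite_Un)
    let ?D = "pattern_set P \<inter> {..<3 * m}"
    have "\<not> T (r ` ?D)" by (rule noT) (use r(2) in auto)
    then obtain g x where g: "g \<in> G" "x \<in> K" "alternating f (fst g) (snd g) x (r ` ?D)"
      unfolding T_def by (auto simp: case_prod_unfold)
    have alt: "if i \<in> P then f (r (3 * i + 1)) x < fst g else snd g < f (r (3 * i + 1)) x" if "i < m" for i
      using g(3)[unfolded alternating_image[OF r(1)], rule_format, OF pattern_set_parity(1)[OF that]]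
        pattern_set_parity(2)[OF that, of P] by simp
    have "R g P N"
      unfolding R_def
    proof (intro bexI[OF _ g(2)] conjI ballI)
      fix n assume "n \<in> P"
      then show "f (r (3 * n + 1)) x < fst g" using alt[of n] m by auto
    next
      fix n assume "n \<in> N"
      then have "n \<notin> P" "n < m" using m PN(3) by auto
      then show "snd g < f (r (3 * n + 1)) x" using alt[of n] by simp
    qed
    then show "\<exists>g\<in>G. R g P N" using g(1) by blast
  qed
  then obtain g m where g: "g \<in> G"
    "\<forall>P N. finite P \<and> finite N \<and> P \<inter> N = {} \<and> P \<union> N \<subseteq> {m..} \<longrightarrow> R g P N"
    by (elim bexE exE)
  let ?r = "\<lambda>n. r (3 * (n + m) + 1)"
  have "strict_mono ?r"
    using r(1) by (auto simp: strict_mono_def)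
  moreover have "independent_seq (\<lambda>n. f (?r n)) K"
    unfolding independent_seq_def
  proof (intro exI conjI allI impI)
    show "fst g < snd g" using G(2) g(1) by (auto simp: case_prod_unfold)
    fix P N :: "nat set"
    assume PN: "finite P \<and> finite N \<and> P \<inter> N = {}"
    have "R g ((\<lambda>n. n + m) ` P) ((\<lambda>n. n + m) ` N)"
      by (rule g(2)[rule_format]) (use PN in auto)
    then show "\<exists>k\<in>K. (\<forall>n\<in>P. f (?r n) k < fst g) \<and> (\<forall>n\<in>N. snd g < f (?r n) k)"
      unfolding R_def by auto
  qed
  ultimately show ?thesis by blast
qed

section \<open>Tameness over bipolars\<close>

text \<open>The bipolar is taken among all linear functionals; when \<open>M\<close> is
  equicontinuous, its members are automatically continuous.\<close>

definition bipolar :: "('a::real_vector \<Rightarrow> real) set \<Rightarrow> ('a \<Rightarrow> real) set" where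
  "bipolar M = {\<phi>. linear \<phi> \<and> (\<forall>x\<in>polar M. \<bar>\<phi> x\<bar> \<le> 1)}"

lemma tame_over_iff:
  "tame_over B K \<longleftrightarrow> (\<exists>C. \<forall>b\<in>B. \<forall>\<phi>\<in>K. \<bar>\<phi> b\<bar> \<le> C)
     \<and> (\<forall>b. range b \<subseteq> B \<longrightarrow> \<not> independent_seq (\<lambda>n \<phi>. \<phi> (b n)) K)"
proof -
  have "(\<exists>s. range s \<subseteq> (\<lambda>b \<phi>. \<phi> b) ` B \<and> independent_seq s K) \<longleftrightarrow>
      (\<exists>b. range b \<subseteq> B \<and> independent_seq (\<lambda>n \<phi>. \<phi> (b n)) K)" (is "?L \<longleftrightarrow> ?R")
  proof
    assume ?L
    then obtain s where s: "range s \<subseteq> (\<lambda>b \<phi>. \<phi> b) ` B" "independent_seq s K" by blast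
    have "\<exists>b\<in>B. s n = (\<lambda>\<phi>. \<phi> b)" for n using s(1) by (auto dest: subsetD)
    then obtain b where b: "\<And>n. b n \<in> B" "\<And>n. s n = (\<lambda>\<phi>. \<phi> (b n))" by metis
    then have "s = (\<lambda>n \<phi>. \<phi> (b n))" by blast
    then show ?R using b(1) s(2) by blast
  next
    assume ?R
    then obtain b where "range b \<subseteq> B" "independent_seq (\<lambda>n \<phi>. \<phi> (b n)) K" by blast
    then show ?L by (intro exI[of _ "\<lambda>n \<phi>. \<phi> (b n)"]) auto
  qed
  then show ?thesis unfolding tame_over_def tame_family_def by auto
qed

lemma independent_seq_mono: "independent_seq f K \<Longrightarrow> K \<subseteq> L \<Longrightarrow> independent_seq f L"
  unfolding independent_seq_def by (meson subsetD)

lemma tame_over_mono: "tame_over B L \<Longrightarrow> K \<subseteq> L \<Longrightarrow> tame_over B K"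
  unfolding tame_over_iff by (meson independent_seq_mono subsetD)

text \<open>Every pattern is realised in \<open>K\<close> or in \<open>L\<close>; the finite cover
  argument, applied to these two sets, makes one of them serve all patterns beyond some
  \<open>m\<close>.\<close>

lemma independent_seq_Un:
  assumes "independent_seq f (K \<union> L)"
  shows "\<exists>m. independent_seq (\<lambda>n. f (n + m)) K \<or> independent_seq (\<lambda>n. f (n + m)) L"
proof -
  obtain a b where ab: "a < b"
    "\<And>P N. finite P \<Longrightarrow> finite N \<Longrightarrow> P \<inter> N = {} \<Longrightarrow> \<exists>k\<in>K \<union> L. (\<forall>n\<in>P. f n k < a) \<and> (\<forall>n\<in>N. f n k > b)"
    using assms unfolding independent_seq_def by metis
  define R where "R K' P N \<longleftrightarrow> (\<exists>k\<in>K'. (\<forall>n\<in>P. f n k < a) \<and> (\<forall>n\<in>N. f n k > b))"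
    for K' and P N :: "nat set"
  have "\<exists>K'\<in>{K, L}. \<exists>m. \<forall>P N. finite P \<and> finite N \<and> P \<inter> N = {} \<and> P \<union> N \<subseteq> {m..} \<longrightarrow> R K' P N"
  proof (rule tail_of_finite_cover)
    show "R K' P N" if "R K' P' N'" "P \<subseteq> P'" "N \<subseteq> N'" for K' P N P' N'
      using that unfolding R_def by blast
    show "\<exists>K'\<in>{K, L}. R K' P N" if "finite P" "finite N" "P \<inter> N = {}" for P N
      using ab(2)[OF that] unfolding R_def by blast
  qed simp
  then obtain K' m where K': "K' \<in> {K, L}"
    "\<forall>P N. finite P \<and> finite N \<and> P \<inter> N = {} \<and> P \<union> N \<subseteq> {m..} \<longrightarrow> R K' P N"
    by (elim bexE exE)
  have "independent_seq (\<lambda>n. f (n + m)) K'"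
    unfolding independent_seq_def
  proof (intro exI conjI allI impI)
    show "a < b" by fact
    fix P N :: "nat set"
    assume PN: "finite P \<and> finite N \<and> P \<inter> N = {}"
    have "R K' ((\<lambda>n. n + m) ` P) ((\<lambda>n. n + m) ` N)"
      by (rule K'(2)[rule_format]) (use PN in auto)
    then show "\<exists>k\<in>K'. (\<forall>n\<in>P. f (n + m) k < a) \<and> (\<forall>n\<in>N. f (n + m) k > b)"
      unfolding R_def by auto
  qed
  then show ?thesis using K'(1) by auto
qed

lemma tame_over_Un:
  assumes "tame_over B K" "tame_over B L"
  shows "tame_over B (K \<union> L)"
  unfolding tame_over_iff
proof (intro conjI allI impI notI)
  obtain C C' where "\<forall>b\<in>B. \<forall>\<phi>\<in>K. \<bar>\<phi> b\<bar> \<le> C" "\<forall>b\<in>B. \<forall>\<phi>\<in>L. \<bar>\<phi> b\<bar> \<le> C'"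
    using assms unfolding tame_over_iff by blast
  then show "\<exists>C. \<forall>b\<in>B. \<forall>\<phi>\<in>K \<union> L. \<bar>\<phi> b\<bar> \<le> C"
    by (intro exI[of _ "max C C'"]) (auto simp: le_max_iff_disj)
next
  fix b :: "nat \<Rightarrow> 'a" assume b: "range b \<subseteq> B" "independent_seq (\<lambda>n \<phi>. \<phi> (b n)) (K \<union> L)"
  from independent_seq_Un[OF this(2)] obtain m where
    "independent_seq (\<lambda>n \<phi>. \<phi> (b (n + m))) K \<or> independent_seq (\<lambda>n \<phi>. \<phi> (b (n + m))) L"
    by blast
  moreover have "range (\<lambda>n. b (n + m)) \<subseteq> B" using b(1) by auto
  ultimately show False using assms unfolding tame_over_iff by blast
qed

text \<open>A negative factor exchanges the two sides of a pattern as well as the thresholds. For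
  \<open>c = 0\<close> all values vanish, and 0 cannot lie both below \<open>l\<close> and above
  \<open>u\<close>.\<close>

lemma independent_seq_scale:
  assumes "independent_seq (\<lambda>n \<phi>. \<phi> (b n)) ((\<lambda>\<phi> x. c * \<phi> x) ` M)"
  shows "independent_seq (\<lambda>n \<phi>. \<phi> (b n)) M"
proof -
  obtain l u where lu: "l < u" "\<And>P N. finite P \<Longrightarrow> finite N \<Longrightarrow> P \<inter> N = {} \<Longrightarrow>
      \<exists>\<phi>\<in>M. (\<forall>n\<in>P. c * \<phi> (b n) < l) \<and> (\<forall>n\<in>N. c * \<phi> (b n) > u)"
    using assms unfolding independent_seq_def by (auto simp del: mult_less_cancel_left)
  consider "c = 0" | "c > 0" | "c < 0" by linarith
  then show ?thesis
  proof cases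
    case 1
    then show ?thesis using lu(2)[of "{0}" "{}"] lu(2)[of "{}" "{0}"] lu(1) by auto
  next
    case 2
    show ?thesis
      unfolding independent_seq_def
    proof (intro exI conjI allI impI)
      show "l / c < u / c" using lu(1) 2 by (simp add: divide_strict_right_mono)
      fix P N :: "nat set" assume PN: "finite P \<and> finite N \<and> P \<inter> N = {}"
      have "\<exists>\<phi>\<in>M. (\<forall>n\<in>P. c * \<phi> (b n) < l) \<and> (\<forall>n\<in>N. c * \<phi> (b n) > u)"
        by (rule lu(2)) (use PN in auto)
      then obtain \<phi> where "\<phi> \<in> M" "\<forall>n\<in>P. c * \<phi> (b n) < l" "\<forall>n\<in>N. c * \<phi> (b n) > u"
        by blast
      then show "\<exists>\<phi>\<in>M. (\<forall>n\<in>P. \<phi> (b n) < l / c) \<and> (\<forall>n\<in>N. u / c < \<phi> (b n))"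
        using 2 by (intro bexI[of _ \<phi>]) (auto simp: field_simps)
    qed
  next
    case 3
    show ?thesis
      unfolding independent_seq_def
    proof (intro exI conjI allI impI)
      show "u / c < l / c" using lu(1) 3 by (simp add: divide_strict_right_mono_neg)
      fix P N :: "nat set" assume PN: "finite P \<and> finite N \<and> P \<inter> N = {}"
      have "\<exists>\<phi>\<in>M. (\<forall>n\<in>N. c * \<phi> (b n) < l) \<and> (\<forall>n\<in>P. c * \<phi> (b n) > u)"
        by (rule lu(2)) (use PN in auto)
      then obtain \<phi> where "\<phi> \<in> M" "\<forall>n\<in>N. c * \<phi> (b n) < l" "\<forall>n\<in>P. c * \<phi> (b n) > u"
        by blast
      then show "\<exists>\<phi>\<in>M. (\<forall>n\<in>P. \<phi> (b n) < u / c) \<and> (\<forall>n\<in>N. l / c < \<phi> (b n))"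
        using 3 by (intro bexI[of _ \<phi>]) (auto simp: field_simps)
    qed
  qed
qed

lemma tame_over_scale:
  assumes "tame_over B M"
  shows "tame_over B ((\<lambda>\<phi> x. c * \<phi> x) ` M)"
  unfolding tame_over_iff
proof (intro conjI allI impI notI)
  obtain C where "\<forall>b\<in>B. \<forall>\<phi>\<in>M. \<bar>\<phi> b\<bar> \<le> C"
    using assms unfolding tame_over_iff by blast
  then show "\<exists>C. \<forall>b\<in>B. \<forall>\<phi>\<in>(\<lambda>\<phi> x. c * \<phi> x) ` M. \<bar>\<phi> b\<bar> \<le> C"
    by (intro exI[of _ "\<bar>c\<bar> * C"]) (auto simp: abs_mult intro: mult_left_mono)
next
  fix b :: "nat \<Rightarrow> 'a"
  assume "range b \<subseteq> B" "independent_seq (\<lambda>n \<phi>. \<phi> (b n)) ((\<lambda>\<phi> x. c * \<phi> x) ` M)"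
  then show False
    using assms independent_seq_scale unfolding tame_over_iff by blast
qed

text \<open>Each condition \<open>\<bar>\<phi> x\<bar> \<le> 1\<close> is closed for pointwise
  convergence and holds on \<open>M\<close> for \<open>x\<close> in the polar.\<close>

lemma closure_subset_bipolar:
  "{\<phi>. linear \<phi>} \<inter> closure M \<subseteq> bipolar M"
proof -
  have "closure M \<subseteq> {\<phi>. \<forall>x\<in>polar M. \<bar>\<phi> x\<bar> \<le> 1}"
  proof (rule closure_minimal)
    show "M \<subseteq> {\<phi>. \<forall>x\<in>polar M. \<bar>\<phi> x\<bar> \<le> 1}"
      by (auto simp: polar_def)
    have "closed {\<phi>. \<bar>\<phi> x\<bar> \<le> (1::real)}" for x :: 'a
      by (intro closed_Collect_le continuous_on_rabs continuous_on_product_coordinates continuous_on_const)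
    then have "closed (\<Inter>x\<in>polar M. {\<phi>. \<bar>\<phi> x\<bar> \<le> (1::real)})"
      by blast
    moreover have "(\<Inter>x\<in>polar M. {\<phi>. \<bar>\<phi> x\<bar> \<le> (1::real)}) = {\<phi>. \<forall>x\<in>polar M. \<bar>\<phi> x\<bar> \<le> 1}"
      by auto
    ultimately show "closed {\<phi>. \<forall>x\<in>polar M. \<bar>\<phi> x\<bar> \<le> (1::real)}" by simp
  qed
  then show ?thesis by (auto simp: bipolar_def)
qed

text \<open>If all values of \<open>M\<close> at \<open>z\<close> were below \<open>d\<close>, then
  \<open>z / d\<close> would lie in the polar and force \<open>\<phi> z \<le> d\<close>. Thus a
  value on the bipolar is transferred to a member of \<open>M\<close>, up to its sign.\<close>

lemma bipolar_gap:
  fixes M :: "('a::real_vector \<Rightarrow> real) set"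
  assumes lin: "M \<subseteq> {\<phi>. linear \<phi>}" and \<phi>: "\<phi> \<in> bipolar M" and d: "0 < d" "d < \<phi> z"
  shows "\<exists>\<psi>\<in>M. d \<le> \<bar>\<psi> z\<bar>"
proof (rule ccontr)
  assume "\<not> ?thesis"
  then have "\<forall>\<psi>\<in>M. \<bar>\<psi> z\<bar> < d" by auto
  then have "(1 / d) *\<^sub>R z \<in> polar M"
    using lin d(1) by (auto simp: polar_def linear_scale abs_mult field_simps less_imp_le dest!: subsetD)
  then have "\<bar>\<phi> ((1 / d) *\<^sub>R z)\<bar> \<le> 1" "linear \<phi>"
    using \<phi> by (auto simp: bipolar_def)
  then have "\<phi> z \<le> d"
    using d(1) by (simp add: linear_scale abs_mult field_simps)
  then show False using d by simp
qed

theorem tame_over_bipolar: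
  fixes M :: "('a::real_vector \<Rightarrow> real) set"
  assumes lin: "M \<subseteq> {\<phi>. linear \<phi>}" and tame: "tame_over B M"
  shows "tame_over B (bipolar M)"
  unfolding tame_over_iff
proof (intro conjI allI impI notI)
  obtain C0 where C0: "\<forall>b\<in>B. \<forall>\<phi>\<in>M. \<bar>\<phi> b\<bar> \<le> C0"
    using tame unfolding tame_over_iff by blast
  define C where "C = max C0 1"
  have C: "C > 0" "\<And>b \<phi>. b \<in> B \<Longrightarrow> \<phi> \<in> M \<Longrightarrow> \<bar>\<phi> b\<bar> \<le> C"
    unfolding C_def using C0 by (auto simp: le_max_iff_disj)
  have "\<bar>\<phi> b\<bar> \<le> C" if "b \<in> B" "\<phi> \<in> bipolar M" for b \<phi>
  proof -
    have "(1 / C) *\<^sub>R b \<in> polar M"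
      using lin C that(1) by (auto simp: polar_def linear_scale abs_mult field_simps dest!: subsetD)
    then have "\<bar>\<phi> ((1 / C) *\<^sub>R b)\<bar> \<le> 1" "linear \<phi>"
      using that by (auto simp: bipolar_def)
    then show ?thesis
      using C(1) by (simp add: linear_scale abs_mult field_simps)
  qed
  then show "\<exists>C. \<forall>b\<in>B. \<forall>\<phi>\<in>bipolar M. \<bar>\<phi> b\<bar> \<le> C" by blast
next
  fix b :: "nat \<Rightarrow> 'a"
  assume b: "range b \<subseteq> B" "independent_seq (\<lambda>n \<phi>. \<phi> (b n)) (bipolar M)"
  obtain l u where lu: "l < u" "\<And>P N. finite P \<Longrightarrow> finite N \<Longrightarrow> P \<inter> N = {} \<Longrightarrow>
      \<exists>\<phi>\<in>bipolar M. (\<forall>n\<in>P. \<phi> (b n) < l) \<and> (\<forall>n\<in>N. u < \<phi> (b n))"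
    using b(2) unfolding independent_seq_def by metis
  \<comment> \<open>\<open>bipolar_gap\<close> controls only an absolute value, whereas the averaged
    gap needs a sign; adding the negatives of \<open>M\<close> supplies it.\<close>
  define K where "K = M \<union> (\<lambda>\<phi> x. - 1 * \<phi> x) ` M"
  have tameK: "tame_over B K"
    unfolding K_def by (rule tame_over_Un[OF tame tame_over_scale[OF tame]])
  obtain C where C: "\<forall>b\<in>B. \<forall>\<phi>\<in>K. \<bar>\<phi> b\<bar> \<le> C"
    using tameK unfolding tame_over_iff by blast
  have "\<exists>r. strict_mono r \<and> independent_seq (\<lambda>n \<phi>. \<phi> (b (r n))) K"
  proof (rule independent_subseq_of_averaged_gap)
    show "\<bar>\<phi> (b n)\<bar> \<le> C" if "\<phi> \<in> K" for n \<phi>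
      using C b(1) that by (meson rangeI subsetD)
    \<comment> \<open>Half of \<open>u - l\<close> leaves the strict inequality that
      \<open>bipolar_gap\<close> requires.\<close>
    show "(u - l) / 2 > 0" using lu(1) by simp
    fix S :: "nat set" and w :: "nat \<Rightarrow> real" and r :: "nat \<Rightarrow> nat"
    assume S: "finite S" "\<forall>j\<in>S. 0 \<le> w j" "sum w S = 1" and r: "strict_mono r"
    define z where "z = (\<Sum>j\<in>S. w j *\<^sub>R (b (r (2 * j + 1)) - b (r (2 * j))))"
    have eval: "\<psi> z = (\<Sum>j\<in>S. w j * (\<psi> (b (r (2 * j + 1))) - \<psi> (b (r (2 * j)))))" if "linear \<psi>" for \<psi>
      unfolding z_def using that by (simp add: linear_sum linear_scale linear_diff)
    have disj: "(\<lambda>j. r (2 * j)) ` S \<inter> (\<lambda>j. r (2 * j + 1)) ` S = {}"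
    proof -
      have "r (2 * i) \<noteq> r (2 * j + 1)" for i j
        using strict_mono_eq[OF r, of "2 * i" "2 * j + 1"] by presburger
      then show ?thesis by auto
    qed
    have fin: "finite ((\<lambda>j. r (2 * j)) ` S)" "finite ((\<lambda>j. r (2 * j + 1)) ` S)"
      using S(1) by auto
    \<comment> \<open>One functional is low at the even and high at the odd members of all pairs, so
      each difference, and with it the weighted mean, is at least \<open>u - l\<close>.\<close>
    obtain \<phi> where \<phi>: "\<phi> \<in> bipolar M" "\<forall>n\<in>(\<lambda>j. r (2 * j)) ` S. \<phi> (b n) < l"
        "\<forall>n\<in>(\<lambda>j. r (2 * j + 1)) ` S. u < \<phi> (b n)"
      using lu(2)[OF fin disj] by blast
    have "u - l = (\<Sum>j\<in>S. w j * (u - l))"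
      using S(3) by (simp add: sum_distrib_right[symmetric])
    also have "\<dots> \<le> (\<Sum>j\<in>S. w j * (\<phi> (b (r (2 * j + 1))) - \<phi> (b (r (2 * j)))))"
    proof (intro sum_mono mult_left_mono)
      fix j assume j: "j \<in> S"
      have "\<phi> (b (r (2 * j))) < l" "u < \<phi> (b (r (2 * j + 1)))"
        using \<phi>(2,3) j by auto
      then show "u - l \<le> \<phi> (b (r (2 * j + 1))) - \<phi> (b (r (2 * j)))" by linarith
      show "0 \<le> w j" using S(2) j by blast
    qed
    also have "\<dots> = \<phi> z"
      by (rule eval[symmetric]) (use \<phi>(1) in \<open>auto simp: bipolar_def\<close>)
    finally have "(u - l) / 2 < \<phi> z" using lu(1) by simp
    then obtain \<psi> where \<psi>: "\<psi> \<in> M" "(u - l) / 2 \<le> \<bar>\<psi> z\<bar>"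
      using bipolar_gap[OF lin \<phi>(1), of "(u - l) / 2" z] lu(1) by auto
    have "\<exists>\<psi>'\<in>K. linear \<psi>' \<and> (u - l) / 2 \<le> \<psi>' z"
    proof (cases "0 \<le> \<psi> z")
      case True
      then show ?thesis using \<psi> lin by (intro bexI[of _ \<psi>]) (auto simp: K_def)
    next
      case False
      have "linear \<psi>" using \<psi> lin by auto
      then have "linear (\<lambda>x. - 1 * \<psi> x)"
        using linear_compose_neg by simp
      then show ?thesis
        using \<psi> False by (intro bexI[of _ "\<lambda>x. - 1 * \<psi> x"]) (auto simp: K_def)
    qed
    then obtain \<psi>' where "\<psi>' \<in> K" "linear \<psi>'" "(u - l) / 2 \<le> \<psi>' z" by blast
    then show "\<exists>x\<in>K. (u - l) / 2 \<le> (\<Sum>j\<in>S. w j * (x (b (r (2 * j + 1))) - x (b (r (2 * j)))))"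
      using eval[of \<psi>'] by (intro bexI[of _ \<psi>']) auto
  qed
  then obtain r where "strict_mono r" "independent_seq (\<lambda>n \<phi>. \<phi> (b (r n))) K" by blast
  moreover have "range (\<lambda>n. b (r n)) \<subseteq> B" using b(1) by auto
  ultimately show False using tameK unfolding tame_over_iff by blast
qed

section \<open>The Hahn-Banach theorem\<close>

definition sublinear :: "('a::real_vector \<Rightarrow> real) \<Rightarrow> bool" where
  "sublinear p \<longleftrightarrow> (\<forall>x y. p (x + y) \<le> p x + p y) \<and> (\<forall>c>0. \<forall>x. p (c *\<^sub>R x) = c * p x)"

lemma sublinear_add: "sublinear p \<Longrightarrow> p (x + y) \<le> p x + p y"
  and sublinear_scale: "sublinear p \<Longrightarrow> c > 0 \<Longrightarrow> p (c *\<^sub>R x) = c * p x"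
  by (auto simp: sublinear_def)

lemma sublinear_0: "sublinear p \<Longrightarrow> p 0 = 0"
  using sublinear_scale[of p 2 0] by simp

lemma sublinear_minus: "sublinear p \<Longrightarrow> - p (- x) \<le> p x"
  using sublinear_add[of p x "- x"] sublinear_0[of p] by simp

lemma sublinearI:
  assumes add: "\<And>x y. p (x + y) \<le> p x + p y" and scale: "\<And>c x. c > 0 \<Longrightarrow> p (c *\<^sub>R x) \<le> c * p x"
  shows "sublinear p"
proof -
  have "p (c *\<^sub>R x) = c * p x" if "c > 0" for c x
    using scale[of c x] scale[of "1 / c" "c *\<^sub>R x"] that by (simp add: field_simps)
  then show ?thesis unfolding sublinear_def using add by blast
qed

text \<open>The one-sided directional modification of \<open>p\<close>: still sublinear, below \<open>p\<close>, and linear along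
  \<open>x\<close>. Hence minimal sublinear functionals are linear.\<close>

definition tangent :: "('a::real_vector \<Rightarrow> real) \<Rightarrow> 'a \<Rightarrow> 'a \<Rightarrow> real" where
  "tangent p x y = Inf ((\<lambda>t. p (y + t *\<^sub>R x) - t * p x) ` {0..})"

lemma tangent_lower:
  assumes p: "sublinear p" and t: "0 \<le> t"
  shows "tangent p x y \<le> p (y + t *\<^sub>R x) - t * p x"
  unfolding tangent_def
proof (rule cInf_lower)
  have "- p (- y) \<le> p (y + s *\<^sub>R x) - s * p x" if "0 \<le> s" for s
  proof -
    have "s * p x = p (s *\<^sub>R x)"
      using sublinear_scale[OF p, of s x] sublinear_0[OF p] that by (cases "s = 0") auto
    also have "s *\<^sub>R x = (y + s *\<^sub>R x) + - y" by simp
    also have "p \<dots> \<le> p (y + s *\<^sub>R x) + p (- y)" by (rule sublinear_add[OF p])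
    finally show ?thesis by simp
  qed
  then show "bdd_below ((\<lambda>t. p (y + t *\<^sub>R x) - t * p x) ` {0..})"
    by (intro bdd_belowI[of _ "- p (- y)"]) auto
qed (use t in auto)

lemma tangent_greatest:
  assumes "\<And>t. 0 \<le> t \<Longrightarrow> c \<le> p (y + t *\<^sub>R x) - t * p x"
  shows "c \<le> tangent p x y"
  unfolding tangent_def by (rule cInf_greatest) (use assms in auto)

lemma sublinear_tangent:
  assumes p: "sublinear p"
  shows "sublinear (tangent p x)"
proof (rule sublinearI)
  fix y z
  have "tangent p x (y + z) - tangent p x z \<le> tangent p x y"
  proof (rule tangent_greatest)
    fix t :: real assume t: "0 \<le> t"
    have "tangent p x (y + z) - (p (y + t *\<^sub>R x) - t * p x) \<le> tangent p x z"
    proof (rule tangent_greatest)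
      fix s :: real assume s: "0 \<le> s"
      have "tangent p x (y + z) \<le> p ((y + z) + (t + s) *\<^sub>R x) - (t + s) * p x"
        using t s by (intro tangent_lower[OF p]) auto
      also have "(y + z) + (t + s) *\<^sub>R x = (y + t *\<^sub>R x) + (z + s *\<^sub>R x)"
        by (simp add: algebra_simps)
      also have "p \<dots> \<le> p (y + t *\<^sub>R x) + p (z + s *\<^sub>R x)" by (rule sublinear_add[OF p])
      finally show "tangent p x (y + z) - (p (y + t *\<^sub>R x) - t * p x) \<le> p (z + s *\<^sub>R x) - s * p x"
        by (simp add: algebra_simps)
    qed
    then show "tangent p x (y + z) - tangent p x z \<le> p (y + t *\<^sub>R x) - t * p x" by simp
  qed
  then show "tangent p x (y + z) \<le> tangent p x y + tangent p x z" by simp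
next
  fix c :: real and y assume c: "c > 0"
  have "tangent p x (c *\<^sub>R y) / c \<le> tangent p x y"
  proof (rule tangent_greatest)
    fix t :: real assume t: "0 \<le> t"
    have "tangent p x (c *\<^sub>R y) \<le> p (c *\<^sub>R y + (c * t) *\<^sub>R x) - (c * t) * p x"
      using c t by (intro tangent_lower[OF p]) auto
    also have "c *\<^sub>R y + (c * t) *\<^sub>R x = c *\<^sub>R (y + t *\<^sub>R x)" by (simp add: algebra_simps)
    also have "p \<dots> = c * p (y + t *\<^sub>R x)" by (rule sublinear_scale[OF p c])
    finally show "tangent p x (c *\<^sub>R y) / c \<le> p (y + t *\<^sub>R x) - t * p x"
      using c by (simp add: field_simps)
  qed
  then show "tangent p x (c *\<^sub>R y) \<le> c * tangent p x y" using c by (simp add: field_simps)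
qed

lemma tangent_le: "sublinear p \<Longrightarrow> tangent p x y \<le> p y"
  using tangent_lower[of p 0 x y] by simp

lemma tangent_minus: "sublinear p \<Longrightarrow> tangent p x (- x) \<le> - p x"
  using tangent_lower[of p 1 x "- x"] sublinear_0[of p] by simp

text \<open>Minimality forces \<open>tangent q x = q\<close> for all \<open>x\<close>, and
  evaluation at \<open>- x\<close> makes \<open>q\<close> odd. An odd subadditive function is
  additive.\<close>

lemma minimal_sublinear_linear:
  assumes q: "sublinear q" and min: "\<And>q'. sublinear q' \<Longrightarrow> (\<And>x. q' x \<le> q x) \<Longrightarrow> q' = q"
  shows "linear q"
proof -
  have "tangent q x = q" for x
    by (rule min[OF sublinear_tangent[OF q]]) (rule tangent_le[OF q])
  then have "q (- x) \<le> - q x" for x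
    using tangent_minus[OF q, of x] by simp
  then have neg: "q (- x) = - q x" for x
    using sublinear_minus[OF q, of x] by (smt (verit))
  show ?thesis
  proof (rule linearI)
    fix x y
    have "q (- (x + y)) \<le> q (- x) + q (- y)"
      using sublinear_add[OF q, of "- x" "- y"] by simp
    then show "q (x + y) = q x + q y"
      using sublinear_add[OF q, of x y] unfolding neg by linarith
  next
    fix c :: real and x
    consider "c = 0" | "c > 0" | "- c > 0" by linarith
    then show "q (c *\<^sub>R x) = c *\<^sub>R q x"
    proof cases
      case 3
      then show ?thesis
        using sublinear_scale[OF q 3, of x] neg[of "c *\<^sub>R x"] by simp
    qed (use sublinear_scale[OF q, of c x] sublinear_0[OF q] in auto)
  qed
qed

text \<open>The values at \<open>x\<close> are bounded below by \<open>- p (- x)\<close>. For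
  subadditivity the chain condition supplies one member that is small at \<open>x\<close> and at
  \<open>y\<close> simultaneously.\<close>

lemma sublinear_chain_Inf:
  assumes p: "sublinear p" and "C \<noteq> {}"
    and C: "\<And>q. q \<in> C \<Longrightarrow> sublinear q" "\<And>q x. q \<in> C \<Longrightarrow> q x \<le> p x"
    and chain: "\<And>q q'. q \<in> C \<Longrightarrow> q' \<in> C \<Longrightarrow> q \<le> q' \<or> q' \<le> q"
  shows "sublinear (\<lambda>x. INF q\<in>C. q x)" "\<And>q x. q \<in> C \<Longrightarrow> (INF q\<in>C. q x) \<le> q x"
proof -
  have bdd: "bdd_below ((\<lambda>q. q x) ` C)" for x
  proof (intro bdd_belowI[of _ "- p (- x)"])
    fix r assume "r \<in> (\<lambda>q. q x) ` C"
    then obtain q where "q \<in> C" "r = q x" by blast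
    then show "- p (- x) \<le> r"
      using sublinear_minus[OF C(1), of q x] C(2)[of q "- x"] by simp
  qed
  show lower: "(INF q\<in>C. q x) \<le> q x" if "q \<in> C" for q x
    by (rule cINF_lower[OF bdd that])
  show "sublinear (\<lambda>x. INF q\<in>C. q x)"
  proof (rule sublinearI)
    fix x y
    have "(INF q\<in>C. q (x + y)) - (INF q\<in>C. q y) \<le> (INF q\<in>C. q x)"
    proof (rule cINF_greatest[OF \<open>C \<noteq> {}\<close>])
      fix q1 assume q1: "q1 \<in> C"
      have "(INF q\<in>C. q (x + y)) - q1 x \<le> (INF q\<in>C. q y)"
      proof (rule cINF_greatest[OF \<open>C \<noteq> {}\<close>])
        fix q2 assume q2: "q2 \<in> C"
        have "\<exists>q\<in>C. q x \<le> q1 x \<and> q y \<le> q2 y"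
          using chain[OF q1 q2] q1 q2 by (auto simp: le_fun_def)
        then obtain q where q: "q \<in> C" "q x \<le> q1 x" "q y \<le> q2 y" by blast
        have "(INF q\<in>C. q (x + y)) \<le> q x + q y"
          using lower[OF q(1), of "x + y"] sublinear_add[OF C(1)[OF q(1)], of x y] by linarith
        then show "(INF q\<in>C. q (x + y)) - q1 x \<le> q2 y" using q(2,3) by linarith
      qed
      then show "(INF q\<in>C. q (x + y)) - (INF q\<in>C. q y) \<le> q1 x" by linarith
    qed
    then show "(INF q\<in>C. q (x + y)) \<le> (INF q\<in>C. q x) + (INF q\<in>C. q y)" by linarith
  next
    fix c :: real and x assume c: "c > 0"
    have "(INF q\<in>C. q (c *\<^sub>R x)) / c \<le> (INF q\<in>C. q x)"
    proof (rule cINF_greatest[OF \<open>C \<noteq> {}\<close>])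
      fix q assume q: "q \<in> C"
      have "(INF q\<in>C. q (c *\<^sub>R x)) \<le> c * q x"
        using lower[OF q, of "c *\<^sub>R x"] sublinear_scale[OF C(1)[OF q] c] by simp
      then show "(INF q\<in>C. q (c *\<^sub>R x)) / c \<le> q x" using c by (simp add: field_simps)
    qed
    then show "(INF q\<in>C. q (c *\<^sub>R x)) \<le> c * (INF q\<in>C. q x)" using c by (simp add: field_simps)
  qed
qed

lemma linear_below_sublinear:
  fixes p :: "'a::real_vector \<Rightarrow> real"
  assumes p: "sublinear p"
  shows "\<exists>\<phi>. linear \<phi> \<and> (\<forall>x. \<phi> x \<le> p x)"
proof -
  define S where "S = {q. sublinear q \<and> (\<forall>x. q x \<le> p x)}"
  \<comment> \<open>The order is reversed, so that the maximal element given by Zorn's lemma is a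
    minimal sublinear functional.\<close>
  define r where "r = {(q, q'). q \<in> S \<and> q' \<in> S \<and> q' \<le> q}"
  have Field: "Field r = S" by (auto simp: r_def Field_def)
  have "Partial_order r"
    unfolding partial_order_on_def preorder_on_def Field
    by (auto simp: r_def refl_on_def trans_def antisym_def intro: order_trans)
  moreover have "\<exists>u\<in>Field r. \<forall>q\<in>C. (q, u) \<in> r" if "C \<in> Chains r" for C
  proof (cases "C = {}")
    case True
    then show ?thesis using p by (auto simp: Field S_def)
  next
    case False
    have C: "q \<in> S" if "q \<in> C" for q
      using \<open>C \<in> Chains r\<close> that by (auto simp: Chains_def r_def)
    have chain: "q \<le> q' \<or> q' \<le> q" if "q \<in> C" "q' \<in> C" for q q'
      using \<open>C \<in> Chains r\<close> that by (auto simp: Chains_def r_def)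
    define u where "u = (\<lambda>x. INF q\<in>C. q x)"
    have u: "sublinear u" "\<And>q x. q \<in> C \<Longrightarrow> u x \<le> q x"
      unfolding u_def using sublinear_chain_Inf[OF p False _ _ chain] C by (auto simp: S_def)
    obtain q where "q \<in> C" using False by blast
    then have "u \<in> S"
      using u C[of q] by (auto simp: S_def intro: order_trans)
    then show ?thesis
      unfolding Field using C u(2) by (intro bexI[of _ u]) (auto simp: r_def le_fun_def)
  qed
  ultimately obtain m where m: "m \<in> S" "\<forall>q\<in>S. (m, q) \<in> r \<longrightarrow> q = m"
    using Zorns_po_lemma[of r] unfolding Field by blast
  have "linear m"
  proof (rule minimal_sublinear_linear)
    show "sublinear m" using m(1) by (simp add: S_def)
    fix q assume q: "sublinear q" "\<And>x. q x \<le> m x"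
    then have "q \<in> S" using m(1) order_trans by (fastforce simp: S_def)
    then show "q = m" using m q(2) by (auto simp: r_def le_fun_def)
  qed
  then show ?thesis using m(1) by (auto simp: S_def)
qed

text \<open>A linear functional below \<open>tangent p x\<close>, not merely below \<open>p\<close>,
  satisfies \<open>\<phi> (- x) \<le> - p x\<close>, which forces equality at \<open>x\<close>. This
  takes the place of an extension from the line through \<open>x\<close>.\<close>

theorem Hahn_Banach_sublinear:
  fixes p :: "'a::real_vector \<Rightarrow> real"
  assumes p: "sublinear p"
  shows "\<exists>\<phi>. linear \<phi> \<and> (\<forall>y. \<phi> y \<le> p y) \<and> \<phi> x = p x"
proof -
  obtain \<phi> where \<phi>: "linear \<phi>" "\<And>y. \<phi> y \<le> tangent p x y"
    using linear_below_sublinear[OF sublinear_tangent[OF p]] by blast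
  have le: "\<phi> y \<le> p y" for y
    using \<phi>(2)[of y] tangent_le[OF p, of x y] by linarith
  have "\<phi> (- x) \<le> - p x"
    using \<phi>(2)[of "- x"] tangent_minus[OF p, of x] by linarith
  then have "p x \<le> \<phi> x" using linear_neg[OF \<phi>(1), of x] by simp
  then show ?thesis using \<phi>(1) le by (metis order_antisym)
qed

text \<open>\<open>p\<close> is the Minkowski gauge of \<open>V\<close>. Outside \<open>V\<close> it
  is at least 1, possibly equal to 1, since \<open>V\<close> need not be closed; hence the weak
  inequality at \<open>x\<close>.\<close>

theorem separate_from_absolutely_convex:
  fixes V :: "'a::real_vector set"
  assumes V: "convex V" "0 \<in> V" and sym: "\<And>v. v \<in> V \<Longrightarrow> - v \<in> V"
    and absorb: "\<And>x. \<exists>t>0. t *\<^sub>R x \<in> V" and x: "x \<notin> V"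
  shows "\<exists>\<phi> :: 'a \<Rightarrow> real. linear \<phi> \<and> (\<forall>v\<in>V. \<bar>\<phi> v\<bar> \<le> 1) \<and> 1 \<le> \<phi> x"
proof -
  define A where "A y = {t. t > 0 \<and> (1 / t) *\<^sub>R y \<in> V}" for y
  define p where "p y = Inf (A y)" for y
  have ne: "A y \<noteq> {}" for y
  proof -
    obtain t where "t > 0" "t *\<^sub>R y \<in> V" using absorb by blast
    then have "1 / t \<in> A y" by (auto simp: A_def)
    then show ?thesis by blast
  qed
  have bdd: "bdd_below (A y)" for y
    by (rule bdd_belowI[of _ 0]) (auto simp: A_def)
  have lower: "p y \<le> t" if "t \<in> A y" for y t
    unfolding p_def by (rule cInf_lower[OF that bdd])
  have greatest: "c \<le> p y" if "\<And>t. t \<in> A y \<Longrightarrow> c \<le> t" for c y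
    unfolding p_def by (rule cInf_greatest[OF ne that])
  have "sublinear p"
  proof (rule sublinearI)
    fix y z
    have sum: "s + t \<in> A (y + z)" if s: "s \<in> A y" and t: "t \<in> A z" for s t
    proof -
      have pos: "s > 0" "t > 0" using s t by (auto simp: A_def)
      have "s / (s + t) + t / (s + t) = 1"
        using pos by (simp add: add_divide_distrib[symmetric])
      then have "(s / (s + t)) *\<^sub>R (1 / s) *\<^sub>R y + (t / (s + t)) *\<^sub>R (1 / t) *\<^sub>R z \<in> V"
        using s t pos by (intro convexD[OF V(1)]) (auto simp: A_def)
      also have "(s / (s + t)) *\<^sub>R (1 / s) *\<^sub>R y + (t / (s + t)) *\<^sub>R (1 / t) *\<^sub>R z = (1 / (s + t)) *\<^sub>R (y + z)"
        using pos by (simp add: scaleR_add_right)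
      finally show ?thesis using pos by (simp add: A_def)
    qed
    have "p (y + z) - p z \<le> p y"
    proof (rule greatest)
      fix s assume s: "s \<in> A y"
      have "p (y + z) - s \<le> p z"
        by (rule greatest) (use lower[OF sum[OF s]] in \<open>simp add: algebra_simps\<close>)
      then show "p (y + z) - p z \<le> s" by linarith
    qed
    then show "p (y + z) \<le> p y + p z" by linarith
  next
    fix c :: real and y assume c: "c > 0"
    have "p (c *\<^sub>R y) / c \<le> p y"
    proof (rule greatest)
      fix t assume "t \<in> A y"
      then have "c * t \<in> A (c *\<^sub>R y)" using c by (auto simp: A_def)
      then show "p (c *\<^sub>R y) / c \<le> t" using lower[of "c * t"] c by (simp add: field_simps)
    qed
    then show "p (c *\<^sub>R y) \<le> c * p y" using c by (simp add: field_simps)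
  qed
  then obtain \<phi> where \<phi>: "linear \<phi>" "\<And>y. \<phi> y \<le> p y" "\<phi> x = p x"
    using Hahn_Banach_sublinear by blast
  have V1: "\<phi> v \<le> 1" if "v \<in> V" for v
    using \<phi>(2)[of v] lower[of 1 v] that by (simp add: A_def)
  have "\<bar>\<phi> v\<bar> \<le> 1" if "v \<in> V" for v
    using V1[OF that] V1[OF sym[OF that]] linear_neg[OF \<phi>(1), of v] by simp
  moreover have "1 \<le> p x"
  proof (rule greatest, rule ccontr)
    fix t assume t: "t \<in> A x" "\<not> 1 \<le> t"
    then have "t *\<^sub>R (1 / t) *\<^sub>R x + (1 - t) *\<^sub>R 0 \<in> V"
      by (intro convexD[OF V(1)]) (auto simp: A_def V(2))
    then show False using x t by (simp add: A_def)
  qed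
  ultimately show ?thesis using \<phi>(1,3) by (intro exI[of _ \<phi>]) auto
qed

section \<open>Mackey's theorem on bounded sets\<close>

lemma nhd0_open: "openin T U \<Longrightarrow> 0 \<in> U \<Longrightarrow> nhd0 T U"
  unfolding nhd0_def by blast

lemma lctvs_topspace: "lctvs T \<Longrightarrow> topspace T = UNIV"
  by (simp add: lctvs_def)

lemma lctvs_translate_vimage:
  assumes T: "lctvs T" and U: "openin T U"
  shows "openin T {y. a + y \<in> U}"
proof -
  have "continuous_map T (prod_topology T T) (\<lambda>y. (a, y))"
    using T by (intro continuous_map_pairedI) (auto simp: lctvs_def)
  moreover have "continuous_map (prod_topology T T) T (\<lambda>(x, y). x + y)"
    using T by (simp add: lctvs_def)
  ultimately have "continuous_map T T ((\<lambda>(x, y). x + y) \<circ> (\<lambda>y. (a, y)))"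
    by (rule continuous_map_compose)
  from openin_continuous_map_preimage[OF this U] show ?thesis
    by (simp add: lctvs_topspace[OF T])
qed

lemma lctvs_scale_vimage:
  assumes T: "lctvs T" and U: "openin T U"
  shows "openin T {y. c *\<^sub>R y \<in> U}"
proof -
  have "continuous_map T (prod_topology euclideanreal T) (\<lambda>y. (c, y))"
    by (intro continuous_map_pairedI) auto
  moreover have "continuous_map (prod_topology euclideanreal T) T (\<lambda>(c, x). c *\<^sub>R x)"
    using T by (simp add: lctvs_def)
  ultimately have "continuous_map T T ((\<lambda>(c, x). c *\<^sub>R x) \<circ> (\<lambda>y. (c, y)))"
    by (rule continuous_map_compose)
  from openin_continuous_map_preimage[OF this U] show ?thesis
    by (simp add: lctvs_topspace[OF T])
qed

lemma lctvs_absorbing: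
  assumes T: "lctvs T" and U: "openin T U" "0 \<in> U"
  shows "\<exists>t>0. t *\<^sub>R x \<in> U"
proof -
  have "continuous_map euclideanreal (prod_topology euclideanreal T) (\<lambda>c. (c, x))"
    using T by (intro continuous_map_pairedI) (auto simp: lctvs_topspace)
  moreover have "continuous_map (prod_topology euclideanreal T) T (\<lambda>(c, x). c *\<^sub>R x)"
    using T by (simp add: lctvs_def)
  ultimately have "continuous_map euclideanreal T ((\<lambda>(c, x). c *\<^sub>R x) \<circ> (\<lambda>c. (c, x)))"
    by (rule continuous_map_compose)
  from openin_continuous_map_preimage[OF this U(1)] have "open {c. c *\<^sub>R x \<in> U}"
    by simp
  moreover have "0 \<in> {c. c *\<^sub>R x \<in> U}" using U(2) by simp
  ultimately obtain e where e: "e > 0" "\<And>c. dist c 0 < e \<Longrightarrow> c \<in> {c. c *\<^sub>R x \<in> U}"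
    unfolding open_dist by blast
  then have "(e / 2) *\<^sub>R x \<in> U" using e(2)[of "e / 2"] by simp
  then show ?thesis using e(1) by (intro exI[of _ "e / 2"]) simp
qed

lemma lctvs_symmetric_base:
  assumes T: "lctvs T" and U: "nhd0 T U"
  obtains V where "openin T V" "0 \<in> V" "convex V" "V \<subseteq> U" "\<And>v. v \<in> V \<Longrightarrow> - v \<in> V"
proof -
  obtain W where W: "openin T W" "0 \<in> W" "convex W" "W \<subseteq> U"
    using T U unfolding lctvs_def by blast
  have "{y. - 1 *\<^sub>R y \<in> W} = uminus ` W"
    by (auto simp: image_iff) (metis minus_minus)
  moreover have "convex (uminus ` W)" using W(3) by (rule convex_negations)
  ultimately have sym: "openin T (W \<inter> uminus ` W)" "convex (W \<inter> uminus ` W)"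
    using W(1,3) lctvs_scale_vimage[OF T W(1), of "- 1"] by (auto intro: convex_Int)
  show thesis
    by (rule that[OF sym(1) _ sym(2)]) (use W in auto)
qed

lemma dualI:
  assumes T: "lctvs T" and lin: "linear \<phi>"
    and small: "\<And>e. e > 0 \<Longrightarrow> \<exists>U. nhd0 T U \<and> (\<forall>x\<in>U. \<bar>\<phi> x\<bar> < e)"
  shows "\<phi> \<in> dual T"
proof -
  have "continuous_map T euclideanreal \<phi>"
    unfolding continuous_map_def
  proof (intro conjI allI impI)
    fix V :: "real set" assume "openin euclideanreal V"
    then have V: "open V" by simp
    show "openin T {x \<in> topspace T. \<phi> x \<in> V}"
    proof (subst openin_subopen, intro ballI)
      fix x assume "x \<in> {x \<in> topspace T. \<phi> x \<in> V}"
      then obtain e where e: "e > 0" "\<And>s. dist s (\<phi> x) < e \<Longrightarrow> s \<in> V"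
        using V unfolding open_dist by blast
      obtain W where W: "openin T W" "0 \<in> W" "\<forall>y\<in>W. \<bar>\<phi> y\<bar> < e"
        using small[OF e(1)] unfolding nhd0_def by blast
      have "\<phi> y \<in> V" if "- x + y \<in> W" for y
        using e(2)[of "\<phi> y"] W(3)[rule_format, OF that]
        by (simp add: linear_add[OF lin] linear_neg[OF lin] linear_diff[OF lin] dist_real_def)
      then show "\<exists>W. openin T W \<and> x \<in> W \<and> W \<subseteq> {x \<in> topspace T. \<phi> x \<in> V}"
        using W lctvs_translate_vimage[OF T W(1), of "- x"] lctvs_topspace[OF T]
        by (intro exI[of _ "{y. - x + y \<in> W}"]) auto
    qed
  qed auto
  then show ?thesis using lin by (simp add: dual_def)
qed

lemma equicontinuous_bounded_on_nhd:
  assumes T: "lctvs T" and V: "openin T V" "0 \<in> V"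
    and M: "\<And>\<phi>. \<phi> \<in> M \<Longrightarrow> linear \<phi>" "\<And>\<phi> v. \<phi> \<in> M \<Longrightarrow> v \<in> V \<Longrightarrow> \<bar>\<phi> v\<bar> \<le> C"
  shows "equicontinuous T M"
  unfolding equicontinuous_def
proof (intro allI impI)
  fix e :: real assume e: "e > 0"
  define c where "c = (\<bar>C\<bar> + 1) / e"
  have c: "c > 0" unfolding c_def using e by simp
  have "\<bar>\<phi> x\<bar> < e" if "\<phi> \<in> M" "c *\<^sub>R x \<in> V" for \<phi> x
  proof -
    have "c * \<bar>\<phi> x\<bar> \<le> C"
      using M(2)[OF that] c by (simp add: linear_scale[OF M(1)[OF that(1)]] abs_mult)
    also have "C < c * e" unfolding c_def using e by simp
    finally show ?thesis using c by simp
  qed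
  moreover have "nhd0 T {x. c *\<^sub>R x \<in> V}"
    by (rule nhd0_open[OF lctvs_scale_vimage[OF T V(1)]]) (simp add: V(2))
  ultimately show "\<exists>U. nhd0 T U \<and> (\<forall>\<phi>\<in>M. \<forall>x\<in>U. \<bar>\<phi> x\<bar> < e)" by blast
qed

lemma equicontinuous_subset_dual:
  assumes "lctvs T" "equicontinuous T M" "\<And>\<phi>. \<phi> \<in> M \<Longrightarrow> linear \<phi>"
  shows "M \<subseteq> dual T"
proof
  fix \<phi> assume \<phi>: "\<phi> \<in> M"
  show "\<phi> \<in> dual T"
  proof (rule dualI[OF assms(1) assms(3)[OF \<phi>]])
    fix e :: real assume "e > 0"
    then obtain U where "nhd0 T U" "\<forall>\<phi>\<in>M. \<forall>x\<in>U. \<bar>\<phi> x\<bar> < e"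
      using assms(2) unfolding equicontinuous_def by blast
    then show "\<exists>U. nhd0 T U \<and> (\<forall>x\<in>U. \<bar>\<phi> x\<bar> < e)" using \<phi> by blast
  qed
qed

lemma dual_linear: "\<phi> \<in> dual T \<Longrightarrow> linear \<phi>"
  by (simp add: dual_def)

lemma dual_open_strip:
  assumes "lctvs T" "\<phi> \<in> dual T"
  shows "openin T {x. \<bar>\<phi> x\<bar> < e}"
proof -
  have "openin T {x \<in> topspace T. \<phi> x \<in> {- e<..<e}}"
    using assms(2) by (intro openin_continuous_map_preimage[of T euclideanreal]) (auto simp: dual_def)
  then show ?thesis
    by (simp add: lctvs_topspace[OF assms(1)] abs_less_iff greaterThanLessThan_def greaterThan_def lessThan_def minus_less_iff conj_commute)
qed

section \<open>Uniform boundedness on a polar by a gliding hump\<close>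

text \<open>The bound is the geometric tail: the sum of \<open>P / 3 ^ k\<close> over
  \<open>k > n\<close> equals \<open>P / 3 ^ n / 2\<close>. Base 3 makes this tail half of the last
  preceding weight, so a hump of relative size \<open>2 / 3\<close> survives it.\<close>

lemma geometric_telescope_limit:
  fixes u :: "nat \<Rightarrow> real"
  assumes step: "\<And>k. \<bar>u (Suc k) - u k\<bar> \<le> P / 3 ^ Suc k"
  shows "\<exists>L. u \<longlonglongrightarrow> L \<and> (\<forall>n. \<bar>L - u n\<bar> \<le> P / 3 ^ n / 2)"
proof -
  have P: "P \<ge> 0" using order_trans[OF abs_ge_zero step[of 0]] by simp
  have tel: "\<bar>u (n + m) - u n\<bar> \<le> P / 3 ^ n / 2 * (1 - 1 / 3 ^ m)" for n m
  proof (induction m)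
    case (Suc m)
    have "\<bar>u (n + Suc m) - u n\<bar> \<le> \<bar>u (n + m) - u n\<bar> + \<bar>u (Suc (n + m)) - u (n + m)\<bar>" by simp
    also have "\<dots> \<le> P / 3 ^ n / 2 * (1 - 1 / 3 ^ m) + P / 3 ^ Suc (n + m)"
      using Suc step[of "n + m"] by linarith
    also have "\<dots> = P / 3 ^ n / 2 * (1 - 1 / 3 ^ Suc m)"
      by (simp add: field_simps power_add)
    finally show ?case .
  qed simp
  have half: "\<bar>u (n + m) - u n\<bar> \<le> P / 3 ^ n / 2" for n m
  proof -
    have "P / 3 ^ n / 2 * (1 - 1 / 3 ^ m) \<le> P / 3 ^ n / 2 * 1"
      using P by (intro mult_left_mono) auto
    then show ?thesis using tel[of n m] by linarith
  qed
  have "(\<lambda>n. P / 2 * (1 / 3) ^ n) \<longlonglongrightarrow> P / 2 * 0"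
    by (intro tendsto_mult tendsto_const LIMSEQ_realpow_zero) auto
  then have lim0: "(\<lambda>n. P / 3 ^ n / 2) \<longlonglongrightarrow> 0"
    by (simp add: power_one_over field_simps)
  have "Cauchy u"
    unfolding Cauchy_altdef2
  proof (intro allI impI)
    fix e :: real assume "e > 0"
    then have "eventually (\<lambda>n. P / 3 ^ n / 2 < e) sequentially"
      using order_tendstoD(2)[OF lim0] by simp
    then obtain N where N: "P / 3 ^ N / 2 < e"
      by (auto simp: eventually_sequentially)
    have "dist (u n) (u N) < e" if "n \<ge> N" for n
      using half[of N "n - N"] that N by (simp add: dist_real_def)
    then show "\<exists>N. \<forall>n\<ge>N. dist (u n) (u N) < e" by blast
  qed
  then obtain L where L: "u \<longlonglongrightarrow> L"
    using Cauchy_convergent_iff convergent_def by blast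
  have "\<bar>L - u n\<bar> \<le> P / 3 ^ n / 2" for n
  proof (rule LIMSEQ_le_const2)
    show "(\<lambda>m. \<bar>u (m + n) - u n\<bar>) \<longlonglongrightarrow> \<bar>L - u n\<bar>"
      by (intro tendsto_rabs tendsto_diff LIMSEQ_ignore_initial_segment[OF L] tendsto_const)
    show "\<exists>N. \<forall>m\<ge>N. \<bar>u (m + n) - u n\<bar> \<le> P / 3 ^ n / 2"
      using half[of n] by (simp add: add.commute)
  qed
  then show ?thesis using L by blast
qed

text \<open>Gliding hump: the sign of the \<open>n\<close>-th term is chosen so that it does not cancel at \<open>b n\<close>.\<close>

primrec hump :: "(nat \<Rightarrow> 'a \<Rightarrow> real) \<Rightarrow> (nat \<Rightarrow> 'a) \<Rightarrow> nat \<Rightarrow> 'a \<Rightarrow> real" where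
  "hump \<phi> b 0 = (\<lambda>x. 0)"
| "hump \<phi> b (Suc n) = (\<lambda>x. hump \<phi> b n x +
     (if 0 \<le> hump \<phi> b n (b n) * \<phi> n (b n) then \<phi> n x else - \<phi> n x) / 3 ^ Suc n)"

lemma hump_step: "\<bar>hump \<phi> b (Suc n) x - hump \<phi> b n x\<bar> = \<bar>\<phi> n x\<bar> / 3 ^ Suc n"
  by (simp add: abs_divide)

lemma hump_peak: "\<bar>\<phi> n (b n)\<bar> / 3 ^ Suc n \<le> \<bar>hump \<phi> b (Suc n) (b n)\<bar>"
proof -
  define s t and c :: real where "s = hump \<phi> b n (b n)" and "t = \<phi> n (b n)" and "c = 3 ^ Suc n"
  have c: "c > 0" by (simp add: c_def)
  have key: "\<bar>r\<bar> \<le> \<bar>s + r\<bar>" if "0 \<le> s * r" for r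
    using that by (auto simp: zero_le_mult_iff abs_if)
  have "\<bar>t / c\<bar> \<le> \<bar>s + (if 0 \<le> s * t then t else - t) / c\<bar>"
  proof (cases "0 \<le> s * t")
    case True
    then have "0 \<le> s * t / c" using c by (intro divide_nonneg_pos) auto
    then show ?thesis using key[of "t / c"] True by simp
  next
    case False
    then have "0 \<le> - (s * t) / c" using c by (intro divide_nonneg_pos) auto
    then show ?thesis using key[of "- t / c"] False by simp
  qed
  then show ?thesis unfolding s_def t_def c_def by (simp add: abs_divide if_distrib)
qed

lemma hump_linear: "(\<And>k. linear (\<phi> k)) \<Longrightarrow> linear (hump \<phi> b n)"
proof (induction n)
  case (Suc n)
  have l: "linear (hump \<phi> b n)" "linear (\<phi> n)" using Suc by auto
  show ?case
    by (rule linearI)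
       (simp_all add: linear_add[OF l(1)] linear_add[OF l(2)] linear_scale[OF l(1)] linear_scale[OF l(2)] field_simps)
qed (simp add: linear_zero)

text \<open>A Banach-Steinhaus argument without completeness of the underlying space: the polar
  contains the sums of the signed series built by \<open>hump\<close>, and this countable convexity
  plays the part of completeness.\<close>

lemma polar_uniformly_bounded:
  fixes V :: "'a::real_vector set" and M :: "('a \<Rightarrow> real) set"
  assumes absorb: "\<And>x. \<exists>t>0. t *\<^sub>R x \<in> V"
    and M: "M = {\<phi>. linear \<phi> \<and> (\<forall>v\<in>V. \<bar>\<phi> v\<bar> \<le> 1)}"
    and pw: "\<And>\<phi>. \<phi> \<in> M \<Longrightarrow> \<exists>C. \<forall>b\<in>B. \<bar>\<phi> b\<bar> \<le> C"
  shows "\<exists>C. \<forall>\<phi>\<in>M. \<forall>b\<in>B. \<bar>\<phi> b\<bar> \<le> C"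
proof (rule ccontr)
  assume "\<not> ?thesis"
  then have unb: "\<exists>\<phi>\<in>M. \<exists>b\<in>B. \<bar>\<phi> b\<bar> > C" for C by (meson not_le)
  define p where "p x = (SUP \<phi>\<in>M. \<bar>\<phi> x\<bar>)" for x
  have bdd: "bdd_above ((\<lambda>\<phi>. \<bar>\<phi> x\<bar>) ` M)" for x
  proof -
    obtain t where t: "t > 0" "t *\<^sub>R x \<in> V" using absorb by blast
    have "\<bar>\<phi> x\<bar> \<le> 1 / t" if "\<phi> \<in> M" for \<phi>
    proof -
      have "\<bar>\<phi> (t *\<^sub>R x)\<bar> \<le> 1" "linear \<phi>" using that t unfolding M by auto
      then show ?thesis using t(1) by (simp add: linear_scale abs_mult field_simps)
    qed
    then show ?thesis by (intro bdd_aboveI[of _ "1 / t"]) auto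
  qed
  have le_p: "\<bar>\<phi> x\<bar> \<le> p x" if "\<phi> \<in> M" for \<phi> x
    unfolding p_def by (rule cSUP_upper[OF that bdd])
  have ne: "M \<noteq> {}" using unb[of 0] by blast
  \<comment> \<open>At \<open>b n\<close> the hump is at least \<open>2 / 3\<close> and the later
    terms together at most \<open>1 / 2\<close> of \<open>p (b n) / 3 ^ Suc n\<close>. A sixth
    remains, and the factor \<open>6 * 3 ^ Suc n\<close> makes it exceed \<open>n\<close>.\<close>
  have "\<exists>b \<phi>. b \<in> B \<and> \<phi> \<in> M \<and> 6 * 3 ^ Suc n * real n < p b \<and> 2 / 3 * p b \<le> \<bar>\<phi> b\<bar>" for n
  proof -
    obtain \<phi>0 b where b: "\<phi>0 \<in> M" "b \<in> B" "\<bar>\<phi>0 b\<bar> > 6 * 3 ^ Suc n * real n"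
      using unb by blast
    then have pb: "6 * 3 ^ Suc n * real n < p b" using le_p[of \<phi>0 b] by linarith
    moreover have "0 \<le> 6 * 3 ^ Suc n * real n" by simp
    ultimately have "2 / 3 * p b < p b" by linarith
    then obtain \<phi> where "\<phi> \<in> M" "2 / 3 * p b < \<bar>\<phi> b\<bar>"
      using less_cSUP_iff[OF ne bdd] unfolding p_def by blast
    then show ?thesis using b(2) pb less_imp_le by blast
  qed
  then obtain b \<phi> where b: "\<And>n. b n \<in> B" and \<phi>: "\<And>n. \<phi> n \<in> M"
    and big: "\<And>n. 6 * 3 ^ Suc n * real n < p (b n)" "\<And>n. 2 / 3 * p (b n) \<le> \<bar>\<phi> n (b n)\<bar>"
    by metis
  have step: "\<bar>hump \<phi> b (Suc k) x - hump \<phi> b k x\<bar> \<le> p x / 3 ^ Suc k" for k x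
    unfolding hump_step by (intro divide_right_mono le_p \<phi>) auto
  obtain \<psi> where \<psi>: "\<And>x. (\<lambda>n. hump \<phi> b n x) \<longlonglongrightarrow> \<psi> x"
    "\<And>x n. \<bar>\<psi> x - hump \<phi> b n x\<bar> \<le> p x / 3 ^ n / 2"
    using geometric_telescope_limit[of "\<lambda>n. hump \<phi> b n _", OF step] by metis
  have lin: "linear (hump \<phi> b n)" for n
    by (rule hump_linear) (use \<phi> in \<open>auto simp: M\<close>)
  have "linear \<psi>"
  proof (rule linearI)
    fix x y
    have "(\<lambda>n. hump \<phi> b n (x + y)) \<longlonglongrightarrow> \<psi> x + \<psi> y"
      unfolding linear_add[OF lin] by (intro tendsto_add \<psi>(1))
    then show "\<psi> (x + y) = \<psi> x + \<psi> y" using LIMSEQ_unique \<psi>(1) by blast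
  next
    fix c x
    have "(\<lambda>n. hump \<phi> b n (c *\<^sub>R x)) \<longlonglongrightarrow> c *\<^sub>R \<psi> x"
      unfolding linear_scale[OF lin] by (intro tendsto_scaleR tendsto_const \<psi>(1))
    then show "\<psi> (c *\<^sub>R x) = c *\<^sub>R \<psi> x" using LIMSEQ_unique \<psi>(1) by blast
  qed
  \<comment> \<open>The partial sum at index 0 vanishes, so the tail estimate there bounds
    \<open>\<bar>\<psi> v\<bar>\<close> by half of \<open>p v\<close>.\<close>
  moreover have "\<bar>\<psi> v\<bar> \<le> 1" if "v \<in> V" for v
  proof -
    have "p v \<le> 1"
      unfolding p_def using ne that by (intro cSUP_least) (auto simp: M)
    then show ?thesis using \<psi>(2)[of v 0] by simp
  qed
  ultimately have "\<psi> \<in> M" unfolding M by blast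
  then obtain C where C: "\<And>n. \<bar>\<psi> (b n)\<bar> \<le> C" using pw b by blast
  obtain n :: nat where n: "real n > C" using reals_Archimedean2 by blast
  define q :: real where "q = 3 ^ Suc n"
  have q: "q > 0" by (simp add: q_def)
  have "2 / 3 * p (b n) / q \<le> \<bar>hump \<phi> b (Suc n) (b n)\<bar>"
    using hump_peak[of \<phi> n b] divide_right_mono[OF big(2)[of n], of q] q unfolding q_def by linarith
  moreover have "\<bar>\<psi> (b n) - hump \<phi> b (Suc n) (b n)\<bar> \<le> p (b n) / q / 2"
    using \<psi>(2)[of "b n" "Suc n"] unfolding q_def .
  ultimately have "2 / 3 * (p (b n) / q) - p (b n) / q / 2 \<le> \<bar>\<psi> (b n)\<bar>" by simp
  moreover have "6 * real n < p (b n) / q"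
    using big(1)[of n] q unfolding q_def[symmetric] by (simp add: field_simps)
  moreover have False if "2 / 3 * s - s / 2 \<le> x" "6 * real n < s" "x \<le> C" for s x :: real
    using that n by linarith
  ultimately show False using C[of n] by blast
qed

text \<open>The polar of a neighbourhood \<open>V\<close> is bounded uniformly on \<open>B\<close>
  by some \<open>C\<close>. If \<open>b / t\<close> lay outside \<open>V\<close>, separation would
  give a member of the polar with value at least \<open>t\<close> at \<open>b\<close>, impossible
  for \<open>t > C\<close>.\<close>

theorem Mackey_bounded:
  fixes T :: "'a::real_vector topology"
  assumes T: "lctvs T" and pw: "\<And>\<phi>. \<phi> \<in> dual T \<Longrightarrow> \<exists>C. \<forall>b\<in>B. \<bar>\<phi> b\<bar> \<le> C"
  shows "tvs_bounded T B"
  unfolding tvs_bounded_def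
proof (intro allI impI)
  fix U assume "nhd0 T U"
  then obtain V where V: "openin T V" "0 \<in> V" "convex V" "V \<subseteq> U" "\<And>v. v \<in> V \<Longrightarrow> - v \<in> V"
    using lctvs_symmetric_base[OF T] by metis
  have absorb: "\<exists>t>0. t *\<^sub>R x \<in> V" for x
    by (rule lctvs_absorbing[OF T V(1,2)])
  define M where "M = {\<phi> :: 'a \<Rightarrow> real. linear \<phi> \<and> (\<forall>v\<in>V. \<bar>\<phi> v\<bar> \<le> 1)}"
  have "equicontinuous T M"
    by (rule equicontinuous_bounded_on_nhd[OF T V(1,2)]) (auto simp: M_def)
  then have "M \<subseteq> dual T"
    by (rule equicontinuous_subset_dual[OF T]) (auto simp: M_def)
  then obtain C where C: "\<forall>\<phi>\<in>M. \<forall>b\<in>B. \<bar>\<phi> b\<bar> \<le> C"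
    using polar_uniformly_bounded[OF absorb M_def] pw by blast
  have "B \<subseteq> (\<lambda>x. t *\<^sub>R x) ` U" if t: "t > \<bar>C\<bar> + 1" for t
  proof
    fix b assume b: "b \<in> B"
    have "(1 / t) *\<^sub>R b \<in> V"
    proof (rule ccontr)
      assume "(1 / t) *\<^sub>R b \<notin> V"
      with V(3,2,5) absorb have
        "\<exists>\<phi> :: 'a \<Rightarrow> real. linear \<phi> \<and> (\<forall>v\<in>V. \<bar>\<phi> v\<bar> \<le> 1) \<and> 1 \<le> \<phi> ((1 / t) *\<^sub>R b)"
        by (rule separate_from_absolutely_convex)
      then obtain \<phi> :: "'a \<Rightarrow> real" where \<phi>: "linear \<phi>" "\<forall>v\<in>V. \<bar>\<phi> v\<bar> \<le> 1" "1 \<le> \<phi> ((1 / t) *\<^sub>R b)"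
        by blast
      then have "t \<le> \<phi> b" using t by (simp add: linear_scale field_simps)
      moreover have "\<bar>\<phi> b\<bar> \<le> C" using C b \<phi> by (auto simp: M_def)
      ultimately show False using t by linarith
    qed
    then show "b \<in> (\<lambda>x. t *\<^sub>R x) ` U"
      using V(4) t by (intro image_eqI[of _ _ "(1 / t) *\<^sub>R b"]) auto
  qed
  then show "\<exists>s>0. \<forall>t>s. B \<subseteq> (\<lambda>x. t *\<^sub>R x) ` U"
    by (intro exI[of _ "\<bar>C\<bar> + 1"]) auto
qed

section \<open>Co-tame sets and the tame topology\<close>

text \<open>The weak-star closure lies between \<open>M\<close> and its bipolar, and tameness over
  these two is equivalent. Later arguments can therefore test \<open>M\<close> itself.\<close>

lemma cotame_iff:
  "M \<in> cotame T \<longleftrightarrow> M \<subseteq> dual T \<and> equicontinuous T M \<and> (\<forall>B. tvs_bounded T B \<longrightarrow> tame_over B M)"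
proof -
  have "tame_over B (wstar_closure T M) \<longleftrightarrow> tame_over B M" if M: "M \<subseteq> dual T" for B
  proof
    have "M \<subseteq> wstar_closure T M"
      using M closure_subset by (auto simp: wstar_closure_def)
    then show "tame_over B (wstar_closure T M) \<Longrightarrow> tame_over B M"
      using tame_over_mono by blast
    have "wstar_closure T M \<subseteq> bipolar M"
      using closure_subset_bipolar[of M] by (auto simp: wstar_closure_def dual_def)
    moreover have "M \<subseteq> {\<phi>. linear \<phi>}" using M by (auto simp: dual_def)
    ultimately show "tame_over B M \<Longrightarrow> tame_over B (wstar_closure T M)"
      using tame_over_bipolar tame_over_mono by blast
  qed
  then show ?thesis unfolding cotame_def by blast
qed

lemma equicontinuous_subset: "equicontinuous T M \<Longrightarrow> N \<subseteq> M \<Longrightarrow> equicontinuous T N"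
  unfolding equicontinuous_def by (meson subsetD)

lemma cotame_mono: "M \<in> cotame T \<Longrightarrow> N \<subseteq> M \<Longrightarrow> N \<in> cotame T"
  unfolding cotame_iff by (meson equicontinuous_subset tame_over_mono order_trans)

lemma nhd0_Int: "nhd0 T U \<Longrightarrow> nhd0 T V \<Longrightarrow> nhd0 T (U \<inter> V)"
  unfolding nhd0_def by (metis IntI Int_mono openin_Int)

lemma equicontinuous_Un:
  assumes "equicontinuous T M" "equicontinuous T N"
  shows "equicontinuous T (M \<union> N)"
  unfolding equicontinuous_def
proof (intro allI impI)
  fix e :: real assume e: "e > 0"
  obtain U where U: "nhd0 T U" "\<forall>\<phi>\<in>M. \<forall>x\<in>U. \<bar>\<phi> x\<bar> < e"
    using assms(1) e unfolding equicontinuous_def by blast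
  obtain V where V: "nhd0 T V" "\<forall>\<phi>\<in>N. \<forall>x\<in>V. \<bar>\<phi> x\<bar> < e"
    using assms(2) e unfolding equicontinuous_def by blast
  show "\<exists>U. nhd0 T U \<and> (\<forall>\<phi>\<in>M \<union> N. \<forall>x\<in>U. \<bar>\<phi> x\<bar> < e)"
    using nhd0_Int[OF U(1) V(1)] U(2) V(2) by (intro exI[of _ "U \<inter> V"]) auto
qed

lemma cotame_Un: "M \<in> cotame T \<Longrightarrow> N \<in> cotame T \<Longrightarrow> M \<union> N \<in> cotame T"
  unfolding cotame_iff using equicontinuous_Un tame_over_Un by blast

lemma cotame_open_polar:
  assumes "M \<in> cotame T"
  obtains V where "openin T V" "0 \<in> V" "V \<subseteq> polar M" "\<And>\<phi> v. \<phi> \<in> M \<Longrightarrow> v \<in> V \<Longrightarrow> \<bar>\<phi> v\<bar> \<le> 1"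
proof -
  have "equicontinuous T M" using assms by (simp add: cotame_def)
  then obtain U where "nhd0 T U" "\<forall>\<phi>\<in>M. \<forall>x\<in>U. \<bar>\<phi> x\<bar> < 1"
    unfolding equicontinuous_def using zero_less_one by blast
  then obtain V where "openin T V" "0 \<in> V" "\<forall>\<phi>\<in>M. \<forall>x\<in>V. \<bar>\<phi> x\<bar> < 1"
    unfolding nhd0_def by blast
  then show thesis by (intro that[of V]) (auto simp: polar_def less_imp_le)
qed

text \<open>Members of \<open>N\<close> are bounded by 1 on the polar of \<open>M\<close>, a
  neighbourhood of zero, and tameness passes to the bipolar. This serves both the hull axiom of the
  bornology and tameness of the new topology.\<close>

lemma cotame_bipolar_subset:
  assumes T: "lctvs T" and M: "M \<in> cotame T" and N: "N \<subseteq> bipolar M"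
  shows "N \<in> cotame T"
proof -
  obtain V where V: "openin T V" "0 \<in> V" "V \<subseteq> polar M" by (rule cotame_open_polar[OF M])
  have lin: "linear \<phi>" if "\<phi> \<in> N" for \<phi> using N that by (auto simp: bipolar_def)
  have eq: "equicontinuous T N"
  proof (rule equicontinuous_bounded_on_nhd[OF T V(1,2)])
    show "\<bar>\<phi> v\<bar> \<le> 1" if "\<phi> \<in> N" "v \<in> V" for \<phi> v
      using that N V(3) by (auto simp: bipolar_def)
  qed (rule lin)
  have "M \<subseteq> {\<phi>. linear \<phi>}" using M by (auto simp: cotame_iff dual_def)
  moreover have "tame_over B M" if "tvs_bounded T B" for B
    using M that by (simp add: cotame_iff)
  ultimately have "tame_over B N" if "tvs_bounded T B" for B
    using tame_over_mono[OF tame_over_bipolar N] that by blast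
  then show ?thesis
    unfolding cotame_iff using eq equicontinuous_subset_dual[OF T eq lin] by blast
qed

lemma cotame_scale:
  assumes T: "lctvs T" and M: "M \<in> cotame T"
  shows "(\<lambda>\<phi> x. c * \<phi> x) ` M \<in> cotame T"
proof -
  obtain V where V: "openin T V" "0 \<in> V" "\<And>\<phi> v. \<phi> \<in> M \<Longrightarrow> v \<in> V \<Longrightarrow> \<bar>\<phi> v\<bar> \<le> 1"
    by (rule cotame_open_polar[OF M]) blast
  have lin: "linear \<phi>" if h: "\<phi> \<in> (\<lambda>\<phi> x. c * \<phi> x) ` M" for \<phi>
  proof -
    obtain \<psi> where \<psi>: "\<psi> \<in> M" "\<phi> = (\<lambda>x. c * \<psi> x)" using h by blast
    then have "linear \<psi>" using M by (auto simp: cotame_iff dual_def)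
    then have "linear (\<lambda>x. c *\<^sub>R \<psi> x)" by (rule linear_compose_scale_right)
    then show ?thesis using \<psi>(2) by simp
  qed
  have eq: "equicontinuous T ((\<lambda>\<phi> x. c * \<phi> x) ` M)"
  proof (rule equicontinuous_bounded_on_nhd[OF T V(1,2)])
    show "\<bar>\<phi> v\<bar> \<le> \<bar>c\<bar> * 1" if "\<phi> \<in> (\<lambda>\<phi> x. c * \<phi> x) ` M" "v \<in> V" for \<phi> v
      using that V(3) by (auto simp: abs_mult intro!: mult_left_le)
  qed (rule lin)
  have "tame_over B ((\<lambda>\<phi> x. c * \<phi> x) ` M)" if "tvs_bounded T B" for B
    by (rule tame_over_scale) (use M that in \<open>simp add: cotame_iff\<close>)
  then show ?thesis
    unfolding cotame_iff using eq equicontinuous_subset_dual[OF T eq lin] by blast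
qed

text \<open>Over one point the patterns \<open>({0}, {})\<close> and \<open>({}, {0})\<close> would
  place the same number below \<open>l\<close> and above \<open>u\<close>. Boundedness on
  \<open>B\<close> comes from absorbing \<open>B\<close> into the strip where
  \<open>\<bar>\<phi> x\<bar> < 1\<close>.\<close>

lemma cotame_singleton:
  assumes T: "lctvs T" and \<phi>: "\<phi> \<in> dual T"
  shows "{\<phi>} \<in> cotame T"
  unfolding cotame_iff
proof (intro conjI allI impI)
  show "equicontinuous T {\<phi>}"
    unfolding equicontinuous_def
  proof (intro allI impI)
    fix e :: real assume "e > 0"
    then have "nhd0 T {x. \<bar>\<phi> x\<bar> < e}"
      by (intro nhd0_open dual_open_strip[OF T \<phi>]) (simp add: linear_0[OF dual_linear[OF \<phi>]])
    then show "\<exists>U. nhd0 T U \<and> (\<forall>\<phi>\<in>{\<phi>}. \<forall>x\<in>U. \<bar>\<phi> x\<bar> < e)" by blast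
  qed
  fix B assume B: "tvs_bounded T B"
  have "nhd0 T {x. \<bar>\<phi> x\<bar> < 1}"
    by (intro nhd0_open dual_open_strip[OF T \<phi>]) (simp add: linear_0[OF dual_linear[OF \<phi>]])
  then obtain s where s: "s > 0" "\<forall>t>s. B \<subseteq> (\<lambda>x. t *\<^sub>R x) ` {x. \<bar>\<phi> x\<bar> < 1}"
    using B unfolding tvs_bounded_def by blast
  then have sub: "B \<subseteq> (\<lambda>x. (s + 1) *\<^sub>R x) ` {x. \<bar>\<phi> x\<bar> < 1}" by simp
  have "\<bar>\<phi> b\<bar> \<le> s + 1" if b: "b \<in> B" for b
  proof -
    obtain x where x: "\<bar>\<phi> x\<bar> < 1" "b = (s + 1) *\<^sub>R x" using sub b by blast
    have "\<bar>\<phi> b\<bar> = (s + 1) * \<bar>\<phi> x\<bar>"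
      using s(1) by (simp add: x(2) linear_scale[OF dual_linear[OF \<phi>]] abs_mult)
    also have "\<dots> \<le> s + 1" using s(1) x(1) by (intro mult_left_le) auto
    finally show ?thesis .
  qed
  moreover have "\<not> independent_seq (\<lambda>n \<psi>. \<psi> (b n)) {\<phi>}" for b
  proof
    assume "independent_seq (\<lambda>n \<psi>. \<psi> (b n)) {\<phi>}"
    then obtain l u where lu: "l < u" "\<forall>P N. finite P \<and> finite N \<and> P \<inter> N = {} \<longrightarrow>
        (\<exists>k\<in>{\<phi>}. (\<forall>n\<in>P. k (b n) < l) \<and> (\<forall>n\<in>N. k (b n) > u))"
      unfolding independent_seq_def by (elim exE conjE)
    show False
      using lu(1) lu(2)[rule_format, of "{0}" "{}"] lu(2)[rule_format, of "{}" "{0}"] by simp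
  qed
  ultimately show "tame_over B {\<phi>}" unfolding tame_over_iff by blast
qed (use \<phi> in simp)

lemma abs_conv_hull_subset_bipolar:
  assumes "M \<subseteq> {\<phi>. linear \<phi>}"
  shows "abs_conv_hull_fun M \<subseteq> bipolar M"
proof
  fix \<phi> assume "\<phi> \<in> abs_conv_hull_fun M"
  then obtain n f c where f: "\<And>i. i < n \<Longrightarrow> f i \<in> M" and c: "(\<Sum>i<n. \<bar>c i\<bar>) \<le> (1::real)"
    and \<phi>: "\<phi> = (\<lambda>x. \<Sum>i<(n::nat). c i * f i x)"
    unfolding abs_conv_hull_fun_def by blast
  have lin: "linear (f i)" if "i < n" for i using f[OF that] assms by blast
  have "linear \<phi>"
  proof (rule linearI)
    show "\<phi> (x + y) = \<phi> x + \<phi> y" for x y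
      unfolding \<phi> sum.distrib[symmetric]
      by (rule sum.cong) (use lin in \<open>auto simp: linear_add distrib_left\<close>)
    show "\<phi> (r *\<^sub>R x) = r *\<^sub>R \<phi> x" for r x
      unfolding \<phi> scaleR_sum_right
      by (rule sum.cong) (use lin in \<open>auto simp: linear_scale\<close>)
  qed
  moreover have "\<bar>\<phi> x\<bar> \<le> 1" if "x \<in> polar M" for x
  proof -
    have "\<bar>\<phi> x\<bar> \<le> (\<Sum>i<n. \<bar>c i * f i x\<bar>)" unfolding \<phi> by (rule sum_abs)
    also have "\<dots> \<le> (\<Sum>i<n. \<bar>c i\<bar>)"
      using that f by (intro sum_mono) (auto simp: abs_mult polar_def intro!: mult_left_le)
    finally show ?thesis using c by linarith
  qed
  ultimately show "\<phi> \<in> bipolar M" by (simp add: bipolar_def)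
qed

theorem convex_bornology_cotame:
  assumes T: "lctvs T"
  shows "convex_bornology (dual T) (cotame T)"
  unfolding convex_bornology_def
proof (intro conjI ballI allI impI)
  fix A assume A: "A \<in> cotame T"
  then show "A \<subseteq> dual T" by (simp add: cotame_def)
  then have "A \<subseteq> {\<phi>. linear \<phi>}" by (auto simp: dual_def)
  then show "abs_conv_hull_fun A \<in> cotame T"
    using cotame_bipolar_subset[OF T A] abs_conv_hull_subset_bipolar by blast
qed (use cotame_singleton[OF T] cotame_mono cotame_Un cotame_scale[OF T] in blast)+

section \<open>Polar topologies of pointwise bounded families\<close>

lemma polar_Un: "polar (M \<union> N) = polar M \<inter> polar N"
  by (auto simp: polar_def)

lemma polar_scale:
  assumes "x \<in> polar ((\<lambda>\<phi> x. c * \<phi> x) ` M)" "\<phi> \<in> M"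
  shows "\<bar>c\<bar> * \<bar>\<phi> x\<bar> \<le> 1"
  using assms by (auto simp: polar_def abs_mult)

context
  fixes BB :: "('a::real_vector \<Rightarrow> real) set set"
  assumes ne: "BB \<noteq> {}"
    and lin: "\<And>M \<phi>. M \<in> BB \<Longrightarrow> \<phi> \<in> M \<Longrightarrow> linear \<phi>"
    and Un: "\<And>M N. M \<in> BB \<Longrightarrow> N \<in> BB \<Longrightarrow> M \<union> N \<in> BB"
    and scale: "\<And>M c. M \<in> BB \<Longrightarrow> (\<lambda>\<phi> x. c * \<phi> x) ` M \<in> BB"
    and pw: "\<And>M x. M \<in> BB \<Longrightarrow> \<exists>C. \<forall>\<phi>\<in>M. \<bar>\<phi> x\<bar> \<le> C"
begin

lemma openin_polar_topology:
  "openin (polar_topology BB) U \<longleftrightarrow> (\<forall>x\<in>U. \<exists>M\<in>BB. (\<lambda>y. x + y) ` polar M \<subseteq> U)"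
proof -
  have "istopology (\<lambda>U. \<forall>x\<in>U. \<exists>M\<in>BB. (\<lambda>y. x + y) ` polar M \<subseteq> U)"
    unfolding istopology_def
  proof (intro conjI allI impI ballI)
    fix S T x
    assume S: "\<forall>x\<in>S. \<exists>M\<in>BB. (+) x ` polar M \<subseteq> S" and T: "\<forall>x\<in>T. \<exists>M\<in>BB. (+) x ` polar M \<subseteq> T"
      and x: "x \<in> S \<inter> T"
    obtain M where M: "M \<in> BB" "(+) x ` polar M \<subseteq> S" using S x by blast
    obtain N where N: "N \<in> BB" "(+) x ` polar N \<subseteq> T" using T x by blast
    show "\<exists>M\<in>BB. (+) x ` polar M \<subseteq> S \<inter> T"
      using Un[OF M(1) N(1)] M(2) N(2) by (intro bexI[of _ "M \<union> N"]) (auto simp: polar_Un)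
  next
    fix \<K> x assume "\<forall>K\<in>\<K>. \<forall>x\<in>K. \<exists>M\<in>BB. (+) x ` polar M \<subseteq> K" "x \<in> \<Union>\<K>"
    then obtain K M where "K \<in> \<K>" "M \<in> BB" "(+) x ` polar M \<subseteq> K" by blast
    then show "\<exists>M\<in>BB. (+) x ` polar M \<subseteq> \<Union>\<K>" by blast
  qed
  then show ?thesis by (simp add: polar_topology_def topology_inverse')
qed

text \<open>Doubling the functionals halves the polar; this is how closure under scalars yields
  continuity of addition.\<close>

lemma half_polar:
  assumes "M \<in> BB"
  shows "\<exists>N\<in>BB. \<forall>x\<in>polar N. \<forall>y\<in>polar N. x + y \<in> polar M"
proof (intro bexI ballI)
  show "(\<lambda>\<phi> x. 2 * \<phi> x) ` M \<in> BB" by (rule scale[OF assms])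
  fix x y assume xy: "x \<in> polar ((\<lambda>\<phi> x. 2 * \<phi> x) ` M)" "y \<in> polar ((\<lambda>\<phi> x. 2 * \<phi> x) ` M)"
  show "x + y \<in> polar M"
    unfolding polar_def
  proof (intro CollectI ballI)
    fix \<phi> assume \<phi>: "\<phi> \<in> M"
    have "2 * \<bar>\<phi> x\<bar> \<le> 1" "2 * \<bar>\<phi> y\<bar> \<le> 1"
      using polar_scale[OF xy(1) \<phi>] polar_scale[OF xy(2) \<phi>] by auto
    then show "\<bar>\<phi> (x + y)\<bar> \<le> 1"
      unfolding linear_add[OF lin[OF assms \<phi>]] by linarith
  qed
qed

lemma zero_in_polar: "M \<in> BB \<Longrightarrow> 0 \<in> polar M"
  by (auto simp: polar_def linear_0[OF lin])

text \<open>Polars need not be open. Collecting the points with a translated polar inside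
  \<open>U\<close> gives an open set, by \<open>half_polar\<close>.\<close>

definition polar_interior :: "'a set \<Rightarrow> 'a set" where
  "polar_interior U = {x. \<exists>M\<in>BB. (\<lambda>y. x + y) ` polar M \<subseteq> U}"

lemma polar_interior_subset: "polar_interior U \<subseteq> U"
proof
  fix x assume "x \<in> polar_interior U"
  then obtain M where "M \<in> BB" "(\<lambda>y. x + y) ` polar M \<subseteq> U" by (auto simp: polar_interior_def)
  then have "x + 0 \<in> U" using zero_in_polar[of M] by blast
  then show "x \<in> U" by simp
qed

lemma openin_polar_interior: "openin (polar_topology BB) (polar_interior U)"
  unfolding openin_polar_topology
proof
  fix x assume "x \<in> polar_interior U"
  then obtain M where M: "M \<in> BB" "(\<lambda>y. x + y) ` polar M \<subseteq> U" by (auto simp: polar_interior_def)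
  obtain N where N: "N \<in> BB" "\<forall>x\<in>polar N. \<forall>y\<in>polar N. x + y \<in> polar M"
    using half_polar[OF M(1)] by blast
  have "x + y \<in> polar_interior U" if "y \<in> polar N" for y
    unfolding polar_interior_def using N that M(2)
    by (intro CollectI bexI[of _ N]) (auto simp: add.assoc)
  then show "\<exists>M\<in>BB. (\<lambda>y. x + y) ` polar M \<subseteq> polar_interior U"
    using N(1) by blast
qed

lemma nhd0_polar_topology: "nhd0 (polar_topology BB) U \<longleftrightarrow> (\<exists>M\<in>BB. polar M \<subseteq> U)"
proof
  assume "nhd0 (polar_topology BB) U"
  then obtain V where V: "openin (polar_topology BB) V" "0 \<in> V" "V \<subseteq> U"
    unfolding nhd0_def by blast
  then show "\<exists>M\<in>BB. polar M \<subseteq> U"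
    unfolding openin_polar_topology by fastforce
next
  assume "\<exists>M\<in>BB. polar M \<subseteq> U"
  then have "0 \<in> polar_interior U" by (auto simp: polar_interior_def)
  then show "nhd0 (polar_topology BB) U"
    unfolding nhd0_def using openin_polar_interior polar_interior_subset by blast
qed

lemma openin_translate_polar:
  assumes "M \<in> BB"
  shows "openin (polar_topology BB) (polar_interior ((\<lambda>y. x + y) ` polar M))"
    "x \<in> polar_interior ((\<lambda>y. x + y) ` polar M)"
  using openin_polar_interior assms by (auto simp: polar_interior_def)

theorem lctvs_polar_topology: "lctvs (polar_topology BB)"
proof -
  let ?S = "polar_topology BB"
  have "openin ?S UNIV" unfolding openin_polar_topology using ne by blast
  then have top: "topspace ?S = UNIV" using openin_subset by blast
  have "continuous_map (prod_topology ?S ?S) ?S (\<lambda>(x, y). x + y)"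
    unfolding continuous_map_def
  proof (intro conjI allI impI)
    fix U assume U: "openin ?S U"
    show "openin (prod_topology ?S ?S) {z \<in> topspace (prod_topology ?S ?S). (case z of (x, y) \<Rightarrow> x + y) \<in> U}"
      unfolding openin_prod_topology_alt
    proof (intro allI impI)
      fix x y assume "(x, y) \<in> {z \<in> topspace (prod_topology ?S ?S). (case z of (x, y) \<Rightarrow> x + y) \<in> U}"
      then obtain M where M: "M \<in> BB" "(\<lambda>z. (x + y) + z) ` polar M \<subseteq> U"
        using U unfolding openin_polar_topology by auto
      obtain N where N: "N \<in> BB" "\<forall>x\<in>polar N. \<forall>y\<in>polar N. x + y \<in> polar M"
        using half_polar[OF M(1)] by blast
      let ?N = "\<lambda>x. polar_interior ((\<lambda>y. x + y) ` polar N)"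
      have "x' + y' \<in> U" if xy': "x' \<in> ?N x" "y' \<in> ?N y" for x' y'
      proof -
        obtain a b where "a \<in> polar N" "b \<in> polar N" "x' = x + a" "y' = y + b"
          using xy' polar_interior_subset by blast
        then show ?thesis using M(2) N(2)[rule_format, of a b] by (auto simp: image_subset_iff algebra_simps)
      qed
      then show "\<exists>V W. openin ?S V \<and> openin ?S W \<and> x \<in> V \<and> y \<in> W \<and>
          V \<times> W \<subseteq> {z \<in> topspace (prod_topology ?S ?S). (case z of (x, y) \<Rightarrow> x + y) \<in> U}"
        using openin_translate_polar[OF N(1)]
        by (intro exI[of _ "?N x"] exI[of _ "?N y"]) (auto simp: top)
    qed
  qed (auto simp: top)
  moreover have "continuous_map (prod_topology euclideanreal ?S) ?S (\<lambda>(c, x). c *\<^sub>R x)"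
    unfolding continuous_map_def
  proof (intro conjI allI impI)
    fix U assume U: "openin ?S U"
    show "openin (prod_topology euclideanreal ?S)
        {z \<in> topspace (prod_topology euclideanreal ?S). (case z of (c, x) \<Rightarrow> c *\<^sub>R x) \<in> U}"
      unfolding openin_prod_topology_alt
    proof (intro allI impI)
      fix c x assume "(c, x) \<in> {z \<in> topspace (prod_topology euclideanreal ?S). (case z of (c, x) \<Rightarrow> c *\<^sub>R x) \<in> U}"
      then obtain M where M: "M \<in> BB" "(\<lambda>z. c *\<^sub>R x + z) ` polar M \<subseteq> U"
        using U unfolding openin_polar_topology by auto
      obtain C0 where C0: "\<forall>\<phi>\<in>M. \<bar>\<phi> x\<bar> \<le> C0" using pw[OF M(1)] by blast
      define C where "C = max C0 0 + 1"
      have C: "C > 0" "\<And>\<phi>. \<phi> \<in> M \<Longrightarrow> \<bar>\<phi> x\<bar> \<le> C" unfolding C_def using C0 by force+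
      \<comment> \<open>The error \<open>c' *\<^sub>R a + (c' - c) *\<^sub>R x\<close> gets a budget
        of 1 in two halves: \<open>d * C \<le> 1 / 2\<close> handles the second term, and
        \<open>k = 2 * (\<bar>c\<bar> + 1)\<close> the first, because \<open>d \<le> 1\<close>
        bounds \<open>\<bar>c'\<bar>\<close> by \<open>\<bar>c\<bar> + 1\<close>.\<close>
      define d where "d = min 1 (1 / (2 * C))"
      have d: "d > 0" "d \<le> 1" "d * C \<le> 1 / 2"
      proof -
        show "d > 0" "d \<le> 1" using C(1) by (auto simp: d_def)
        have "d * C \<le> 1 / (2 * C) * C" using C(1) by (intro mult_right_mono) (auto simp: d_def)
        then show "d * C \<le> 1 / 2" using C(1) by simp
      qed
      define k where "k = 2 * (\<bar>c\<bar> + 1)"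
      define N where "N = (\<lambda>\<phi> x. k * \<phi> x) ` M"
      have N: "N \<in> BB" unfolding N_def by (rule scale[OF M(1)])
      let ?N = "polar_interior ((\<lambda>y. x + y) ` polar N)"
      have "c' *\<^sub>R x' \<in> U" if c': "\<bar>c' - c\<bar> < d" and x': "x' \<in> ?N" for c' x'
      proof -
        obtain a where a: "a \<in> polar N" "x' = x + a"
          using x' polar_interior_subset by blast
        have "c' *\<^sub>R a + (c' - c) *\<^sub>R x \<in> polar M"
          unfolding polar_def
        proof (intro CollectI ballI)
          fix \<phi> assume \<phi>: "\<phi> \<in> M"
          note l = lin[OF M(1) \<phi>]
          have "k * \<bar>\<phi> a\<bar> \<le> 1"
            using polar_scale[OF a(1)[unfolded N_def] \<phi>] by (simp add: k_def)
          moreover have "\<bar>c'\<bar> * \<bar>\<phi> a\<bar> \<le> (\<bar>c\<bar> + 1) * \<bar>\<phi> a\<bar>"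
            using c' d(2) by (intro mult_right_mono) auto
          ultimately have "\<bar>c'\<bar> * \<bar>\<phi> a\<bar> \<le> 1 / 2" by (simp add: k_def algebra_simps)
          moreover have "\<bar>c' - c\<bar> * \<bar>\<phi> x\<bar> \<le> d * C"
            using c' C(2)[OF \<phi>] d(1) by (intro mult_mono) auto
          moreover have "\<bar>\<phi> (c' *\<^sub>R a + (c' - c) *\<^sub>R x)\<bar> \<le> \<bar>c'\<bar> * \<bar>\<phi> a\<bar> + \<bar>c' - c\<bar> * \<bar>\<phi> x\<bar>"
            unfolding linear_add[OF l] linear_scale[OF l] abs_mult[symmetric] by (simp add: abs_triangle_ineq)
          ultimately show "\<bar>\<phi> (c' *\<^sub>R a + (c' - c) *\<^sub>R x)\<bar> \<le> 1" using d(3) by linarith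
        qed
        then have "c *\<^sub>R x + (c' *\<^sub>R a + (c' - c) *\<^sub>R x) \<in> U" using M(2) by blast
        then show ?thesis using a(2) by (simp add: algebra_simps)
      qed
      then show "\<exists>V W. openin euclideanreal V \<and> openin ?S W \<and> c \<in> V \<and> x \<in> W \<and>
          V \<times> W \<subseteq> {z \<in> topspace (prod_topology euclideanreal ?S). (case z of (c, x) \<Rightarrow> c *\<^sub>R x) \<in> U}"
        using openin_translate_polar[OF N] d(1)
        by (intro exI[of _ "ball c d"] exI[of _ ?N]) (auto simp: top dist_real_def abs_minus_commute)
    qed
  qed (auto simp: top)
  moreover have "\<exists>V. openin ?S V \<and> 0 \<in> V \<and> convex V \<and> V \<subseteq> U" if U: "nhd0 ?S U" for U
  proof -
    obtain M where M: "M \<in> BB" "polar M \<subseteq> U" using U unfolding nhd0_polar_topology by blast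
    have conv: "convex (polar M)"
    proof (rule convexI, unfold polar_def, intro CollectI ballI)
      fix x y u v \<phi>
      assume xy: "x \<in> {x. \<forall>\<phi>\<in>M. \<bar>\<phi> x\<bar> \<le> 1}" "y \<in> {x. \<forall>\<phi>\<in>M. \<bar>\<phi> x\<bar> \<le> 1}"
        and uv: "0 \<le> u" "0 \<le> v" "u + v = (1::real)" and \<phi>: "\<phi> \<in> M"
      note l = lin[OF M(1) \<phi>]
      have "\<bar>u * \<phi> x\<bar> \<le> u" "\<bar>v * \<phi> y\<bar> \<le> v"
        using xy uv \<phi> by (auto simp: abs_mult intro!: mult_left_le)
      then show "\<bar>\<phi> (u *\<^sub>R x + v *\<^sub>R y)\<bar> \<le> 1"
        unfolding linear_add[OF l] linear_scale[OF l] using uv(3) by simp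
    qed
    have "convex (polar_interior (polar M))"
    proof (rule convexI)
      fix x y and u v :: real
      assume x: "x \<in> polar_interior (polar M)" and y: "y \<in> polar_interior (polar M)"
        and uv: "0 \<le> u" "0 \<le> v" "u + v = 1"
      obtain A where A: "A \<in> BB" "(\<lambda>z. x + z) ` polar A \<subseteq> polar M" using x by (auto simp: polar_interior_def)
      obtain B where B: "B \<in> BB" "(\<lambda>z. y + z) ` polar B \<subseteq> polar M" using y by (auto simp: polar_interior_def)
      \<comment> \<open>One \<open>z\<close> from both polars may be added to \<open>x\<close> and
        to \<open>y\<close>; as \<open>u + v = 1\<close>, it survives the convex combination
        unchanged.\<close>
      have "(u *\<^sub>R x + v *\<^sub>R y) + z \<in> polar M" if "z \<in> polar (A \<union> B)" for z
      proof -
        have "x + z \<in> polar M" "y + z \<in> polar M"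
          using that A(2) B(2) by (auto simp: polar_Un)
        then have "u *\<^sub>R (x + z) + v *\<^sub>R (y + z) \<in> polar M"
          using uv by (intro convexD[OF conv])
        moreover have "u *\<^sub>R (x + z) + v *\<^sub>R (y + z) = (u *\<^sub>R x + v *\<^sub>R y) + (u + v) *\<^sub>R z"
          by (simp add: algebra_simps)
        ultimately show ?thesis using uv(3) by simp
      qed
      then show "u *\<^sub>R x + v *\<^sub>R y \<in> polar_interior (polar M)"
        unfolding polar_interior_def using Un[OF A(1) B(1)] by blast
    qed
    moreover have "0 \<in> polar_interior (polar M)"
      using M(1) by (auto simp: polar_interior_def)
    ultimately show ?thesis
      using openin_polar_interior polar_interior_subset[of "polar M"] M(2) by blast
  qed
  ultimately show ?thesis
    unfolding lctvs_def using top by blast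
qed

end

section \<open>The tame topology: compactness, comparison and tameness\<close>

lemma cotame_pointwise_bounded:
  assumes T: "lctvs T" and M: "M \<in> cotame T"
  shows "\<exists>C. \<forall>\<phi>\<in>M. \<bar>\<phi> x\<bar> \<le> C"
proof -
  obtain V where V: "openin T V" "0 \<in> V" "\<And>\<phi> v. \<phi> \<in> M \<Longrightarrow> v \<in> V \<Longrightarrow> \<bar>\<phi> v\<bar> \<le> 1"
    by (rule cotame_open_polar[OF M]) blast
  obtain t where t: "t > 0" "t *\<^sub>R x \<in> V" using lctvs_absorbing[OF T V(1,2)] by blast
  have "\<bar>\<phi> x\<bar> \<le> 1 / t" if "\<phi> \<in> M" for \<phi>
  proof -
    have "linear \<phi>" using M that by (auto simp: cotame_def dual_def)
    then show ?thesis
      using V(3)[OF that t(2)] t(1) by (simp add: linear_scale abs_mult field_simps)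
  qed
  then show ?thesis by blast
qed

text \<open>The Alaoglu argument: absorption confines the value at each \<open>x\<close> to a
  compact interval, and linearity and the bounds on \<open>V\<close> are closed conditions in the
  product.\<close>

lemma compact_polar_of_absorbing:
  fixes V :: "'a::real_vector set"
  assumes absorb: "\<And>x. \<exists>t>0. t *\<^sub>R x \<in> V"
  shows "compact {\<phi> :: 'a \<Rightarrow> real. linear \<phi> \<and> (\<forall>v\<in>V. \<bar>\<phi> v\<bar> \<le> 1)}"
proof -
  let ?M = "{\<phi> :: 'a \<Rightarrow> real. linear \<phi> \<and> (\<forall>v\<in>V. \<bar>\<phi> v\<bar> \<le> 1)}"
  obtain t where t: "\<And>x. t x > 0" "\<And>x. t x *\<^sub>R x \<in> V" using absorb by metis
  have "compactin (product_topology (\<lambda>x::'a. euclideanreal) UNIV) (Pi\<^sub>E UNIV (\<lambda>x. {- (1 / t x)..1 / t x}))"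
    by (simp add: compactin_PiE)
  then have cpt: "compact (Pi\<^sub>E UNIV (\<lambda>x. {- (1 / t x)..1 / t x}))"
    by (simp add: euclidean_product_topology)
  have clo: "closed ?M"
  proof -
    have cont: "continuous_on UNIV (\<lambda>\<phi> :: 'a \<Rightarrow> real. \<phi> x)" for x
      by (rule continuous_on_product_coordinates)
    have "closed {\<phi> :: 'a \<Rightarrow> real. \<phi> (x + y) = \<phi> x + \<phi> y}" for x y
      by (intro closed_Collect_eq continuous_on_add cont)
    moreover have "closed {\<phi> :: 'a \<Rightarrow> real. \<phi> (c *\<^sub>R x) = c *\<^sub>R \<phi> x}" for c x
      by (intro closed_Collect_eq continuous_on_scaleR continuous_on_const cont)
    moreover have "closed {\<phi> :: 'a \<Rightarrow> real. \<bar>\<phi> x\<bar> \<le> 1}" for x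
      by (intro closed_Collect_le continuous_on_rabs continuous_on_const cont)
    ultimately have "closed ((\<Inter>x. \<Inter>y. {\<phi> :: 'a \<Rightarrow> real. \<phi> (x + y) = \<phi> x + \<phi> y})
        \<inter> (\<Inter>c. \<Inter>x. {\<phi>. \<phi> (c *\<^sub>R x) = c *\<^sub>R \<phi> x}) \<inter> (\<Inter>x\<in>V. {\<phi>. \<bar>\<phi> x\<bar> \<le> 1}))"
      by (intro closed_Int closed_INT ballI)
    moreover have "(\<Inter>x. \<Inter>y. {\<phi> :: 'a \<Rightarrow> real. \<phi> (x + y) = \<phi> x + \<phi> y})
        \<inter> (\<Inter>c. \<Inter>x. {\<phi>. \<phi> (c *\<^sub>R x) = c *\<^sub>R \<phi> x}) \<inter> (\<Inter>x\<in>V. {\<phi>. \<bar>\<phi> x\<bar> \<le> 1}) = ?M"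
      by (auto simp: linear_iff)
    ultimately show ?thesis by simp
  qed
  have "?M \<subseteq> Pi\<^sub>E UNIV (\<lambda>x. {- (1 / t x)..1 / t x})"
  proof
    fix \<phi> assume \<phi>: "\<phi> \<in> ?M"
    have "\<bar>\<phi> x\<bar> \<le> 1 / t x" for x
    proof -
      have "\<bar>\<phi> (t x *\<^sub>R x)\<bar> \<le> 1" "linear \<phi>" using \<phi> t(2) by auto
      then show ?thesis using t(1)[of x] by (simp add: linear_scale abs_mult field_simps)
    qed
    then show "\<phi> \<in> Pi\<^sub>E UNIV (\<lambda>x. {- (1 / t x)..1 / t x})"
      by (auto simp: abs_le_iff minus_le_iff)
  qed
  then show ?thesis
    using compact_Int_closed[OF cpt clo] by (simp only: Int_absorb1)
qed

lemma tame_topology_coarser: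
  assumes T: "lctvs T"
    and open_tame: "\<And>U. openin (tame_topology T) U \<longleftrightarrow> (\<forall>x\<in>U. \<exists>M\<in>cotame T. (\<lambda>y. x + y) ` polar M \<subseteq> U)"
  shows "coarser (tame_topology T) T"
  unfolding coarser_def
proof (intro allI impI)
  fix U assume U: "openin (tame_topology T) U"
  show "openin T U"
  proof (subst openin_subopen, intro ballI)
    fix x assume "x \<in> U"
    then obtain M where M: "M \<in> cotame T" "(\<lambda>y. x + y) ` polar M \<subseteq> U"
      using U open_tame by blast
    obtain V where V: "openin T V" "0 \<in> V" "V \<subseteq> polar M" by (rule cotame_open_polar[OF M(1)])
    have "y \<in> U" if "- x + y \<in> V" for y
    proof -
      have "x + (- x + y) \<in> U" using that V(3) M(2) by blast
      then show ?thesis by simp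
    qed
    then show "\<exists>W. openin T W \<and> x \<in> W \<and> W \<subseteq> U"
      using lctvs_translate_vimage[OF T V(1), of "- x"] V(2)
      by (intro exI[of _ "{y. - x + y \<in> V}"]) auto
  qed
qed

lemma dual_coarser: "lctvs S \<Longrightarrow> lctvs T \<Longrightarrow> coarser S T \<Longrightarrow> dual S \<subseteq> dual T"
  by (auto simp: dual_def coarser_def continuous_map_def lctvs_topspace)

lemma nhd0_coarser: "coarser S T \<Longrightarrow> nhd0 S U \<Longrightarrow> nhd0 T U"
  unfolding nhd0_def coarser_def by blast

lemma tvs_bounded_coarser: "coarser S T \<Longrightarrow> tvs_bounded T B \<Longrightarrow> tvs_bounded S B"
  unfolding tvs_bounded_def using nhd0_coarser by blast

lemma equicontinuous_coarser: "coarser S T \<Longrightarrow> equicontinuous S M \<Longrightarrow> equicontinuous T M"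
  unfolding equicontinuous_def using nhd0_coarser by meson

lemma tame_coarser_tame_topology:
  fixes S T :: "'a::real_vector topology"
  assumes T: "lctvs T" and S: "lctvs S" and ST: "coarser S T" and tame: "tame_lcs S"
    and open_tame: "\<And>U. openin (tame_topology T) U \<longleftrightarrow> (\<forall>x\<in>U. \<exists>M\<in>cotame T. (\<lambda>y. x + y) ` polar M \<subseteq> U)"
  shows "coarser S (tame_topology T)"
  unfolding coarser_def open_tame
proof (intro allI impI ballI)
  fix U x assume U: "openin S U" "x \<in> U"
  have U0: "nhd0 S {y. x + y \<in> U}"
    by (rule nhd0_open[OF lctvs_translate_vimage[OF S U(1)]]) (use U(2) in simp)
  obtain V where V: "openin S V" "0 \<in> V" "convex V" "V \<subseteq> {y. x + y \<in> U}" "\<And>v. v \<in> V \<Longrightarrow> - v \<in> V"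
    by (rule lctvs_symmetric_base[OF S U0]) blast
  have absorb: "\<exists>t>0. t *\<^sub>R x \<in> V" for x
    by (rule lctvs_absorbing[OF S V(1,2)])
  define M where "M = {\<phi> :: 'a \<Rightarrow> real. linear \<phi> \<and> (\<forall>v\<in>V. \<bar>\<phi> v\<bar> \<le> 1)}"
  have eq: "equicontinuous S M"
    by (rule equicontinuous_bounded_on_nhd[OF S V(1,2)]) (auto simp: M_def)
  have dual: "M \<subseteq> dual S"
    by (rule equicontinuous_subset_dual[OF S eq]) (auto simp: M_def)
  have "compact M" unfolding M_def by (rule compact_polar_of_absorbing[OF absorb])
  \<comment> \<open>Sets bounded for \<open>T\<close> are bounded for the coarser \<open>S\<close>,
    so tameness of \<open>S\<close> covers every set that co-tameness in \<open>T\<close> has to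
    test.\<close>
  then have "tame_over B M" if "tvs_bounded T B" for B
    using tame tvs_bounded_coarser[OF ST that] dual eq unfolding tame_lcs_def by blast
  then have M: "M \<in> cotame T"
    unfolding cotame_iff using dual_coarser[OF S T ST] dual equicontinuous_coarser[OF ST eq] by blast
  \<comment> \<open>Separation yields only \<open>1 \<le> \<phi> y\<close>, which is compatible with
    \<open>y\<close> in the polar of \<open>M\<close>; doubling \<open>M\<close> lowers the bound to
    \<open>1 / 2\<close> and gives the contradiction.\<close>
  have "y \<in> V" if y: "y \<in> polar ((\<lambda>\<phi> x. 2 * \<phi> x) ` M)" for y
  proof (rule ccontr)
    assume "y \<notin> V"
    with V(3,2,5) absorb have "\<exists>\<phi> :: 'a \<Rightarrow> real. linear \<phi> \<and> (\<forall>v\<in>V. \<bar>\<phi> v\<bar> \<le> 1) \<and> 1 \<le> \<phi> y"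
      by (rule separate_from_absolutely_convex)
    then obtain \<phi> where \<phi>: "\<phi> \<in> M" "1 \<le> \<phi> y" unfolding M_def by blast
    then show False using polar_scale[OF y \<phi>(1)] by simp
  qed
  then have "(\<lambda>y. x + y) ` polar ((\<lambda>\<phi> x. 2 * \<phi> x) ` M) \<subseteq> U" using V(4) by blast
  then show "\<exists>M\<in>cotame T. (\<lambda>y. x + y) ` polar M \<subseteq> U"
    using cotame_scale[OF T M] by blast
qed

lemma weak_topology_coarser_tame:
  assumes T: "lctvs T"
    and open_tame: "\<And>U. openin (tame_topology T) U \<longleftrightarrow> (\<forall>x\<in>U. \<exists>M\<in>cotame T. (\<lambda>y. x + y) ` polar M \<subseteq> U)"
  shows "coarser (weak_topology T) (tame_topology T)"
proof -
  have sub: "openin (tame_topology T) W" if mem: "W \<in> {\<phi> -` V | \<phi> V. \<phi> \<in> dual T \<and> open V}" for W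
    unfolding open_tame
  proof
    fix x assume x: "x \<in> W"
    obtain \<phi> V where W: "W = \<phi> -` V" "\<phi> \<in> dual T" "open V" using mem by blast
    obtain e where e: "e > 0" "\<And>s. dist s (\<phi> x) < e \<Longrightarrow> s \<in> V"
      using W x unfolding open_dist by blast
    \<comment> \<open>The factor \<open>2 / e\<close> gives
      \<open>\<bar>\<phi> y\<bar> \<le> e / 2\<close>, hence the strict inequality required by the
      ball in \<open>V\<close>.\<close>
    have "x + y \<in> W" if "y \<in> polar ((\<lambda>\<phi> x. (2 / e) * \<phi> x) ` {\<phi>})" for y
    proof -
      have "\<bar>2 / e\<bar> * \<bar>\<phi> y\<bar> \<le> 1" by (rule polar_scale[OF that]) simp
      then have "\<bar>\<phi> y\<bar> < e" using e(1) by (simp add: field_simps)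
      then show ?thesis
        using e(2)[of "\<phi> (x + y)"] by (simp add: W(1) linear_add[OF dual_linear[OF W(2)]] dist_real_def)
    qed
    then show "\<exists>M\<in>cotame T. (\<lambda>y. x + y) ` polar M \<subseteq> W"
      using cotame_scale[OF T cotame_singleton[OF T W(2)], of "2 / e"] by blast
  qed
  show ?thesis
    unfolding coarser_def weak_topology_def openin_topology_generated_by_iff
  proof (intro allI impI)
    fix U assume "generate_topology_on {\<phi> -` V | \<phi> V. \<phi> \<in> dual T \<and> open V} U"
    from generate_topology_on_coarsest[OF istopology_openin sub this]
    show "openin (tame_topology T) U" by simp
  qed
qed

lemma tame_lcs_tame_topology:
  assumes T: "lctvs T" and S: "lctvs (tame_topology T)" and ST: "coarser (tame_topology T) T"
    and nhd0_tame: "\<And>U. nhd0 (tame_topology T) U \<longleftrightarrow> (\<exists>M\<in>cotame T. polar M \<subseteq> U)"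
  shows "tame_lcs (tame_topology T)"
  unfolding tame_lcs_def
proof (intro allI impI, elim conjE)
  fix B K
  assume B: "tvs_bounded (tame_topology T) B" and K: "K \<subseteq> dual (tame_topology T)"
    "equicontinuous (tame_topology T) K"
  \<comment> \<open>Polars of single functionals are neighbourhoods of zero because singletons are
    co-tame. Hence every functional in the dual of \<open>T\<close> is bounded on
    \<open>B\<close>.\<close>
  have "tvs_bounded T B"
  proof (rule Mackey_bounded[OF T])
    fix \<phi> assume \<phi>: "\<phi> \<in> dual T"
    have "nhd0 (tame_topology T) (polar {\<phi>})"
      unfolding nhd0_tame using cotame_singleton[OF T \<phi>] by blast
    then obtain s where s: "s > 0" "\<forall>t>s. B \<subseteq> (\<lambda>x. t *\<^sub>R x) ` polar {\<phi>}"
      using B unfolding tvs_bounded_def by blast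
    then have sub: "B \<subseteq> (\<lambda>x. (s + 1) *\<^sub>R x) ` polar {\<phi>}" by simp
    have "\<bar>\<phi> b\<bar> \<le> s + 1" if b: "b \<in> B" for b
    proof -
      obtain x where x: "\<bar>\<phi> x\<bar> \<le> 1" "b = (s + 1) *\<^sub>R x" using sub b by (auto simp: polar_def)
      have "\<bar>\<phi> b\<bar> = (s + 1) * \<bar>\<phi> x\<bar>"
        using s(1) by (simp add: x(2) linear_scale[OF dual_linear[OF \<phi>]] abs_mult)
      also have "\<dots> \<le> s + 1" using s(1) x(1) by (intro mult_left_le) auto
      finally show ?thesis .
    qed
    then show "\<exists>C. \<forall>b\<in>B. \<bar>\<phi> b\<bar> \<le> C" by blast
  qed
  moreover obtain U where U: "nhd0 (tame_topology T) U" "\<forall>\<phi>\<in>K. \<forall>x\<in>U. \<bar>\<phi> x\<bar> < 1"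
    using K(2) zero_less_one unfolding equicontinuous_def by blast
  then obtain M where M: "M \<in> cotame T" "polar M \<subseteq> U" unfolding nhd0_tame by blast
  \<comment> \<open>Equicontinuity with bound 1 holds on a neighbourhood that contains
    \<open>polar M\<close>.\<close>
  have "K \<subseteq> bipolar M"
    unfolding bipolar_def using K(1) U(2) M(2) by (fastforce simp: dual_def)
  then have "K \<in> cotame T" by (rule cotame_bipolar_subset[OF T M(1)])
  ultimately show "tame_over B K" unfolding cotame_iff by blast
qed

theorem theorem6p10:
  fixes \<tau> :: "'a::real_vector topology"
  assumes "lctvs \<tau>"
  shows "convex_bornology (dual \<tau>) (cotame \<tau>)
    \<and> lctvs (tame_topology \<tau>)
    \<and> coarser (tame_topology \<tau>) \<tau>
    \<and> tame_lcs (tame_topology \<tau>)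
    \<and> (\<forall>\<sigma>. lctvs \<sigma> \<and> coarser \<sigma> \<tau> \<and> tame_lcs \<sigma> \<longrightarrow> coarser \<sigma> (tame_topology \<tau>))
    \<and> coarser (weak_topology \<tau>) (tame_topology \<tau>)
    \<and> (\<forall>\<mu>. mackey_topology \<tau> \<mu> \<longrightarrow> coarser \<tau> \<mu>)"
proof -
  have "(\<lambda>x. 0) \<in> dual \<tau>" by (simp add: dual_def linear_zero)
  then have ne: "cotame \<tau> \<noteq> {}" using cotame_singleton[OF assms] by blast
  have lin: "linear \<phi>" if "M \<in> cotame \<tau>" "\<phi> \<in> M" for M \<phi>
    using that by (auto simp: cotame_def dual_def)
  note polar_facts = ne lin cotame_Un cotame_scale[OF assms] cotame_pointwise_bounded[OF assms]
  have open_tame: "openin (tame_topology \<tau>) U \<longleftrightarrow>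
      (\<forall>x\<in>U. \<exists>M\<in>cotame \<tau>. (\<lambda>y. x + y) ` polar M \<subseteq> U)" for U
    unfolding tame_topology_def by (rule openin_polar_topology[OF polar_facts])
  have nhd0_tame: "nhd0 (tame_topology \<tau>) U \<longleftrightarrow> (\<exists>M\<in>cotame \<tau>. polar M \<subseteq> U)" for U
    unfolding tame_topology_def by (rule nhd0_polar_topology[OF polar_facts])
  have lctvs_tame: "lctvs (tame_topology \<tau>)"
    unfolding tame_topology_def by (rule lctvs_polar_topology[OF polar_facts])
  have coarser_tame: "coarser (tame_topology \<tau>) \<tau>"
    by (rule tame_topology_coarser[OF assms open_tame])
  \<comment> \<open>The Mackey comparison holds because \<tau> is itself one of the locally convex
    topologies with this dual over which \<mu> is maximal.\<close>
  show ?thesis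
    using convex_bornology_cotame[OF assms] lctvs_tame coarser_tame
      tame_lcs_tame_topology[OF assms lctvs_tame coarser_tame nhd0_tame]
      tame_coarser_tame_topology[OF assms _ _ _ open_tame]
      weak_topology_coarser_tame[OF assms open_tame] assms
    unfolding mackey_topology_def by blast
qed

end
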